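(* Let $\lambda_0\ge 0$, $\lambda_1\ge 0$. (i) If there is a strategy $(\chi,\psi)\in\mathscr F$ such that $$L(\chi,\psi)=\inf_{(\chi',\psi')\in\mathscr F}L(\chi',\psi'),\qquad ( * )$$ then for every $k=1,2,\dots$ $$I_{\{l_k^\chi<f_{\theta_0}^{k,\chi}+R_k^\chi\}}\le\psi_k^\chi\le I_{\{l_k^\chi\le f_{\theta_0}^{k,\chi}+R_k^\chi\}}\qquad (a)$$ $\mu^k$-almost everywhere on $C_k^{\psi,\chi}$, and $$\int V_{k+1}^\chi(y^{(k+1)})\,d\mu(y_{k+1})=R_k^\chi(y^{(k)})\qquad (b)$$ $\mu^k$-almost everywhere on $\bar C_k^{\psi,\chi}$, and moreover $\chi_1$ is such that $$\int V_1^\chi(y_1)\,d\mu(y_1)=R_0.\qquad (c)$$ (ii) Conversely, if a strategy $(\chi,\psi)$ (a control policy and a stopping rule) satisfies, for every $k=1,2,\dots$, (a) $\mu^k$-almost everywhere on $C_k^{\psi,\chi}$ and (b) $\mu^k$-almost everywhere on $\bar C_k^{\psi,\chi}$, and $\chi_1$ satisfies (c), then $(\chi,\psi)\in\mathscr F$ and $( * )$ holds.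
   Context: Model. Controls $x$ take values in a measurable space; responses $y$ take values in a measurable space with a $\sigma$-finite measure $\mu$. For $\theta\in\{\theta_0,\theta_1\}$, $f_\theta(y|x)$ (measurable in $(x,y)$) is the density with respect to $\mu$ of the response when control $x$ is applied. Given controls, observations are independent; with $x^{(n)}=(x_1,\dots,x_n)$, $y^{(n)}=(y_1,\dots,y_n)$ put $f_\theta^n=f_\theta^n(x^{(n)},y^{(n)})=\prod_{i=1}^n f_\theta(y_i|x_i)$, a density with respect to the product measure $\mu^n=\mu\otimes\dots\otimes\mu$. A control policy is $\chi=(\chi_1,\chi_2,\dots)$ with $\chi_n=\chi_n(x^{(n-1)},y^{(n-1)})$ measurable, with values in the control space ($\chi_1$ is a constant); the control at stage $n$ is $x_n=\chi_n(x^{(n-1)},y^{(n-1)})$. A stopping rule is $\psi=(\psi_1,\psi_2,\dots)$ with $\psi_n=\psi_n(x^{(n)},y^{(n)})\in[0,1]$ measurable, the conditional probability of stopping at stage $n$. A pair $(\chi,\psi)$ is called a strategy. For any function $F_n=F_n(x^{(n)},y^{(n)})$ let $F_n^\chi(y^{(n)})=F_n(x^{(n)},y^{(n)})$ with $x_i=\chi_i(x^{(i-1)},y^{(i-1)})$, $i=1,\dots,n$; in particular $f_\theta^{n,\chi}=(f_\theta^n)^\chi$. Expectations are $E_\theta^\chi F_n=\int F_n^\chi f_\theta^{n,\chi}d\mu^n$. The stopping time $\tau_\psi$ has $P_\theta^\chi(\tau_\psi=n)=E_\theta^\chi(1-\psi_1)\cdots(1-\psi_{n-1})\psi_n$. $\mathscr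 F$ is the set of strategies with $\lim_{n\to\infty}E_{\theta_0}^\chi(1-\psi_1)\cdots(1-\psi_n)=0$, equivalently $P_{\theta_0}^\chi(\tau_\psi<\infty)=1$. Let $s_n^{\psi,\chi}=(1-\psi_1^\chi)\cdots(1-\psi_{n-1}^\chi)\psi_n^\chi$, $l_n=\min\{\lambda_0f_{\theta_0}^n,\lambda_1f_{\theta_1}^n\}$, and for $(\chi,\psi)\in\mathscr F$ $$L(\chi,\psi)=\sum_{n=1}^\infty\int s_n^{\psi,\chi}\,(nf_{\theta_0}^{n,\chi}+l_n^\chi)\,d\mu^n .$$ Let $C_1^{\psi,\chi}$ be the whole space of $y^{(1)}$; for $n\ge2$, $C_n^{\psi,\chi}=\{y^{(n)}:(1-\psi_1^\chi(y^{(1)}))\cdots(1-\psi_{n-1}^\chi(y^{(n-1)}))>0\}$; for $n\ge1$, $\bar C_n^{\psi,\chi}=\{y^{(n)}:(1-\psi_1^\chi(y^{(1)}))\cdots(1-\psi_n^\chi(y^{(n)}))>0\}$. For $N\ge1$ set $V_N^N=l_N$ and recursively for $k=N,N-1,\dots,2$: $V_{k-1}^N=\min\{l_{k-1},f_{\theta_0}^{k-1}+R_{k-1}^N\}$, where $R_{k-1}^N(x^{(k-1)},y^{(k-1)})=\min_{x_k}\int V_k^N(x^{(k)},y^{(k)})\,d\mu(y_k)$; also $R_0^N=\min_{x_1}\int V_1^N(x_1,y_1)d\mu(y_1)$. For fixed $r\ge 1$ the sequence $V_r^N$ is non-increasing in $N\ge r$; let $V_r=\lim_{N\to\infty}V_r^N$,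 $R_r(x^{(r)},y^{(r)})=\min_{x_{r+1}}\int V_{r+1}(x^{(r+1)},y^{(r+1)})d\mu(y_{r+1})$ for $r\ge1$, and $R_0=\min_{x_1}\int V_1(x_1,y_1)d\mu(y_1)$. Standing assumption: all the functions $R_k^N$, $R_k$ and the numbers $R_0^N$, $R_0$ are well defined (the minima exist), and the functions are measurable (this is true, e.g., if the controls can take only finitely many values). $I_A$ denotes the indicator of $A$. *)

theory Defs
  imports "HOL-Analysis.Analysis"
begin

text \<open>
  Sequences \<open>x\<^sup>(\<^sup>n\<^sup>) = (x\<^sub>1,\<dots>,x\<^sub>n)\<close> are extensional functions on \<open>{1..n}\<close>, i.e. points of
  \<^term>\<open>Pi\<^sub>M {1..n} (\<lambda>_. M)\<close>; the empty sequence is \<^term>\<open>\<lambda>_. undefined\<close>. A function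
  \<open>F\<^sub>n(x\<^sup>(\<^sup>n\<^sup>), y\<^sup>(\<^sup>n\<^sup>))\<close> is written \<open>F n x y\<close>, and the density \<open>f\<^sub>\<theta>(y|x)\<close> is written \<open>f x y\<close>.
  Of the control space \<open>X\<close> only the measurable structure is used. The control policy is called \<open>\<xi>\<close>
  because \<open>\<chi>\<close> is a binder in HOL-Analysis.
\<close>

abbreviation seq_space :: "'a measure \<Rightarrow> nat \<Rightarrow> (nat \<Rightarrow> 'a) measure" where
  "seq_space M n \<equiv> Pi\<^sub>M {1..n} (\<lambda>_. M)"

type_synonym ('x, 'y) policy = "nat \<Rightarrow> (nat \<Rightarrow> 'x) \<Rightarrow> (nat \<Rightarrow> 'y) \<Rightarrow> 'x"
type_synonym ('x, 'y) stage_fun = "nat \<Rightarrow> (nat \<Rightarrow> 'x) \<Rightarrow> (nat \<Rightarrow> 'y) \<Rightarrow> real"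

definition cond_density :: "'x measure \<Rightarrow> 'y measure \<Rightarrow> ('x \<Rightarrow> 'y \<Rightarrow> real) \<Rightarrow> bool" where
  "cond_density X M f \<longleftrightarrow>
     case_prod f \<in> borel_measurable (X \<Otimes>\<^sub>M M) \<and>
     (\<forall>x\<in>space X. \<forall>y\<in>space M. 0 \<le> f x y) \<and>
     (\<forall>x\<in>space X. (\<integral>\<^sup>+y. ennreal (f x y) \<partial>M) = 1)"

definition joint_density :: "('x \<Rightarrow> 'y \<Rightarrow> real) \<Rightarrow> ('x, 'y) stage_fun" where
  "joint_density f n x y = (\<Prod>i=1..n. f (x i) (y i))"

definition control_policy :: "'x measure \<Rightarrow> 'y measure \<Rightarrow> ('x, 'y) policy \<Rightarrow> bool" where
  "control_policy X M \<xi> \<longleftrightarrow>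
     (\<forall>n\<ge>1. case_prod (\<xi> n) \<in> measurable (seq_space X (n - 1) \<Otimes>\<^sub>M seq_space M (n - 1)) X)"

definition stopping_rule :: "'x measure \<Rightarrow> 'y measure \<Rightarrow> ('x, 'y) stage_fun \<Rightarrow> bool" where
  "stopping_rule X M \<psi> \<longleftrightarrow>
     (\<forall>n\<ge>1. case_prod (\<psi> n) \<in> borel_measurable (seq_space X n \<Otimes>\<^sub>M seq_space M n) \<and>
        (\<forall>x\<in>space (seq_space X n). \<forall>y\<in>space (seq_space M n). \<psi> n x y \<in> {0..1}))"

text \<open>\<open>controls \<xi> y n\<close> is the control sequence \<open>x\<^sup>(\<^sup>n\<^sup>)\<close> generated by \<open>\<xi>\<close> from the responses
  \<open>y\<^sub>1,\<dots>,y\<^sub>n\<^sub>-\<^sub>1\<close>, and \<open>along \<xi> F n\<close> is \<open>F\<^sub>n\<^sup>\<xi>\<close>. Both truncate \<open>y\<close> to the coordinates they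
  may depend on, so \<open>along \<xi> F i y\<close> is also meaningful for \<open>y\<close> in \<open>seq_space M n\<close>, \<open>n \<ge> i\<close>.\<close>

primrec controls :: "('x, 'y) policy \<Rightarrow> (nat \<Rightarrow> 'y) \<Rightarrow> nat \<Rightarrow> nat \<Rightarrow> 'x" where
  "controls \<xi> y 0 = (\<lambda>_. undefined)"
| "controls \<xi> y (Suc n) =
     (controls \<xi> y n)(Suc n := \<xi> (Suc n) (controls \<xi> y n) (restrict y {1..n}))"

definition along :: "('x, 'y) policy \<Rightarrow> ('x, 'y) stage_fun \<Rightarrow> nat \<Rightarrow> (nat \<Rightarrow> 'y) \<Rightarrow> real" where
  "along \<xi> F n y = F n (controls \<xi> y n) (restrict y {1..n})"

definition continue_prob ::
    "('x, 'y) policy \<Rightarrow> ('x, 'y) stage_fun \<Rightarrow> nat \<Rightarrow> (nat \<Rightarrow> 'y) \<Rightarrow> real" where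
  "continue_prob \<xi> \<psi> n y = (\<Prod>i=1..n. 1 - along \<xi> \<psi> i y)"

definition stop_prob ::
    "('x, 'y) policy \<Rightarrow> ('x, 'y) stage_fun \<Rightarrow> nat \<Rightarrow> (nat \<Rightarrow> 'y) \<Rightarrow> real" where
  "stop_prob \<xi> \<psi> n y = continue_prob \<xi> \<psi> (n - 1) y * along \<xi> \<psi> n y"

text \<open>The sets \<open>C\<^sub>n\<close> (the whole space for \<open>n = 1\<close>, the product being empty) and \<open>\<bar>C\<^sub>n\<close>.\<close>

definition reach_set ::
    "'y measure \<Rightarrow> ('x, 'y) policy \<Rightarrow> ('x, 'y) stage_fun \<Rightarrow> nat \<Rightarrow> (nat \<Rightarrow> 'y) set" where
  "reach_set M \<xi> \<psi> n = {y \<in> space (seq_space M n). continue_prob \<xi> \<psi> (n - 1) y > 0}"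

definition continue_set ::
    "'y measure \<Rightarrow> ('x, 'y) policy \<Rightarrow> ('x, 'y) stage_fun \<Rightarrow> nat \<Rightarrow> (nat \<Rightarrow> 'y) set" where
  "continue_set M \<xi> \<psi> n = {y \<in> space (seq_space M n). continue_prob \<xi> \<psi> n y > 0}"

definition stage_expectation ::
    "'y measure \<Rightarrow> ('x \<Rightarrow> 'y \<Rightarrow> real) \<Rightarrow> ('x, 'y) policy \<Rightarrow> nat \<Rightarrow> ((nat \<Rightarrow> 'y) \<Rightarrow> real) \<Rightarrow> real" where
  "stage_expectation M f \<xi> n G =
     (\<integral>y. G y * along \<xi> (joint_density f) n y \<partial>seq_space M n)"

definition strategies :: "'x measure \<Rightarrow> 'y measure \<Rightarrow> ('x \<Rightarrow> 'y \<Rightarrow> real) \<Rightarrow>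
    (('x, 'y) policy \<times> ('x, 'y) stage_fun) set" where
  "strategies X M f0 = {(\<xi>, \<psi>). control_policy X M \<xi> \<and> stopping_rule X M \<psi> \<and>
     (\<lambda>n. stage_expectation M f0 \<xi> n (continue_prob \<xi> \<psi> n)) \<longlonglongrightarrow> 0}"

text \<open>\<open>next_integral M k G x y a\<close> is \<open>\<integral> G(x\<^sup>(\<^sup>k\<^sup>+\<^sup>1\<^sup>), y\<^sup>(\<^sup>k\<^sup>+\<^sup>1\<^sup>)) d\<mu>(y\<^sub>k\<^sub>+\<^sub>1)\<close> with \<open>x\<^sub>k\<^sub>+\<^sub>1 = a\<close>. Its
  minimum over \<open>a\<close> is written as an infimum; that it is attained is part of
  \<open>standing_assumption\<close> below.\<close>

definition next_integral :: "'y measure \<Rightarrow> nat \<Rightarrow> ((nat \<Rightarrow> 'x) \<Rightarrow> (nat \<Rightarrow> 'y) \<Rightarrow> real) \<Rightarrow>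
    (nat \<Rightarrow> 'x) \<Rightarrow> (nat \<Rightarrow> 'y) \<Rightarrow> 'x \<Rightarrow> real" where
  "next_integral M k G x y a = (\<integral>z. G (x(Suc k := a)) (y(Suc k := z)) \<partial>M)"

definition min_next :: "'x measure \<Rightarrow> 'y measure \<Rightarrow> nat \<Rightarrow>
    ((nat \<Rightarrow> 'x) \<Rightarrow> (nat \<Rightarrow> 'y) \<Rightarrow> real) \<Rightarrow> (nat \<Rightarrow> 'x) \<Rightarrow> (nat \<Rightarrow> 'y) \<Rightarrow> real" where
  "min_next X M k G x y = (INF a\<in>space X. next_integral M k G x y a)"

context
  fixes X :: "'x measure" and M :: "'y measure"
    and f0 f1 :: "'x \<Rightarrow> 'y \<Rightarrow> real" and lam0 lam1 :: real
begin

definition term_loss :: "('x, 'y) stage_fun" where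
  "term_loss n x y = min (lam0 * joint_density f0 n x y) (lam1 * joint_density f1 n x y)"

text \<open>The sum starts at stage 1, hence the shift. The value may be \<open>\<infinity>\<close>.\<close>

definition loss :: "('x, 'y) policy \<Rightarrow> ('x, 'y) stage_fun \<Rightarrow> ennreal" where
  "loss \<xi> \<psi> = (\<Sum>j. let n = Suc j in
     \<integral>\<^sup>+y. ennreal (stop_prob \<xi> \<psi> n y *
        (real n * along \<xi> (joint_density f0) n y + along \<xi> term_loss n y)) \<partial>seq_space M n)"

definition optimal :: "('x, 'y) policy \<Rightarrow> ('x, 'y) stage_fun \<Rightarrow> bool" where
  "optimal \<xi> \<psi> \<longleftrightarrow> loss \<xi> \<psi> = (INF (\<xi>', \<psi>')\<in>strategies X M f0. loss \<xi>' \<psi>')"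

text \<open>\<open>V_trunc N k\<close> is \<open>V\<^sub>k\<^sup>N\<close>; only \<open>1 \<le> k \<le> N\<close> matters.\<close>

function V_trunc :: "nat \<Rightarrow> ('x, 'y) stage_fun" where
  "V_trunc N k = (if k < N
     then (\<lambda>x y. min (term_loss k x y)
            (joint_density f0 k x y + min_next X M k (V_trunc N (Suc k)) x y))
     else term_loss k)"
  by pat_completeness auto
termination by (relation "Wellfounded.measure (\<lambda>(N, k). N - k)") auto

declare V_trunc.simps [simp del]

definition R_trunc :: "nat \<Rightarrow> ('x, 'y) stage_fun" where
  "R_trunc N k = min_next X M k (V_trunc N (Suc k))"

definition V_lim :: "('x, 'y) stage_fun" where
  "V_lim k x y = lim (\<lambda>N. V_trunc N k x y)"

definition R_lim :: "('x, 'y) stage_fun" where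
  "R_lim k = min_next X M k (V_lim (Suc k))"

text \<open>The case \<open>k = 0\<close> covers the numbers \<open>R\<^sub>0\<^sup>N\<close> and \<open>R\<^sub>0\<close>: there the only arguments are the
  empty sequences, and measurability is vacuous.\<close>

definition standing_assumption :: bool where
  "standing_assumption \<longleftrightarrow>
     (\<forall>k. \<forall>x\<in>space (seq_space X k). \<forall>y\<in>space (seq_space M k).
        (\<forall>N>k. \<exists>a. is_arg_min (next_integral M k (V_trunc N (Suc k)) x y) (\<lambda>a. a \<in> space X) a) \<and>
        (\<exists>a. is_arg_min (next_integral M k (V_lim (Suc k)) x y) (\<lambda>a. a \<in> space X) a)) \<and>
     (\<forall>k. (\<forall>N>k. case_prod (R_trunc N k) \<in> borel_measurable (seq_space X k \<Otimes>\<^sub>M seq_space M k)) \<and>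
        case_prod (R_lim k) \<in> borel_measurable (seq_space X k \<Otimes>\<^sub>M seq_space M k))"

definition stopping_condition :: "('x, 'y) policy \<Rightarrow> ('x, 'y) stage_fun \<Rightarrow> nat \<Rightarrow> bool" where
  "stopping_condition \<xi> \<psi> k \<longleftrightarrow>
     (AE y in seq_space M k. y \<in> reach_set M \<xi> \<psi> k \<longrightarrow>
        indicator {y. along \<xi> term_loss k y
                      < along \<xi> (joint_density f0) k y + along \<xi> R_lim k y} y \<le> along \<xi> \<psi> k y \<and>
        along \<xi> \<psi> k y \<le> indicator {y. along \<xi> term_loss k y
                      \<le> along \<xi> (joint_density f0) k y + along \<xi> R_lim k y} y)"

definition control_condition :: "('x, 'y) policy \<Rightarrow> ('x, 'y) stage_fun \<Rightarrow> nat \<Rightarrow> bool" where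
  "control_condition \<xi> \<psi> k \<longleftrightarrow>
     (AE y in seq_space M k. y \<in> continue_set M \<xi> \<psi> k \<longrightarrow>
        (\<integral>z. along \<xi> V_lim (Suc k) (y(Suc k := z)) \<partial>M) = along \<xi> R_lim k y)"

definition initial_condition :: "('x, 'y) policy \<Rightarrow> bool" where
  "initial_condition \<xi> \<longleftrightarrow>
     (\<integral>z. along \<xi> V_lim 1 ((\<lambda>_. undefined)(1 := z)) \<partial>M)
       = R_lim 0 (\<lambda>_. undefined) (\<lambda>_. undefined)"

end

end

theory Submission
  imports Defs
begin

text \<open>
  The functions \<open>V\<^sub>k\<close> and \<open>R\<^sub>k\<close> depend on the data only through the two joint densities
  \<open>p = f\<^sub>0\<^sup>k\<close> and \<open>q = f\<^sub>1\<^sup>k\<close>, and not on \<open>k\<close>: there are functions \<open>W\<close> (\<open>limit_value\<close>) and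
  \<open>R p q = (INF a. \<integral> W (p f\<^sub>0(z|a)) (q f\<^sub>1(z|a)) d\<mu>(z))\<close> on the quadrant with
  \<open>W = min {l, p + R}\<close>, where \<open>l p q = min {\<lambda>\<^sub>0 p, \<lambda>\<^sub>1 q}\<close> (\<open>V_lim_eq\<close>, \<open>R_lim_eq\<close>,
  \<open>limit_value_eq\<close>).

  Fix a strategy. Let \<open>A\<^sub>n\<close> be the \<open>n\<close>-th term of its loss and let \<open>B\<^sub>n\<close> be the integral of
  \<open>(n + 1) p + R\<close>, weighted with the probability of continuing after stage \<open>n\<close>; thus
  \<open>B\<^sub>0 = 1 + R\<^sub>0\<close>. Replacing the best control by the one that the policy prescribes can only increase
  \<open>R\<close>, and replacing \<open>W = min {l, p + R}\<close> by a convex combination of \<open>l\<close> and \<open>p + R\<close> can only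
  increase \<open>W\<close>. Hence \<open>B\<^sub>n \<le> A\<^sub>n\<^sub>+\<^sub>1 + B\<^sub>n\<^sub>+\<^sub>1\<close>. Equality in the first replacement is the condition on
  the controls, equality in the second the condition on the stopping rule; together, for all \<open>n\<close>, they
  are the conditions of the theorem (\<open>conditions_iff_stepwise\<close>).

  The sums \<open>A\<^sub>1 + \<dots> + A\<^sub>m + B\<^sub>m\<close> therefore increase from \<open>1 + R\<^sub>0\<close>. For a strategy that stops
  almost surely they never exceed the loss (\<open>partial_risk_le_loss\<close>), because \<open>(m + 1) P(\<tau> > m)\<close> is
  dominated by the sampling cost after stage \<open>m\<close>. So \<open>1 + R\<^sub>0\<close> is a lower bound for the loss. If the
  conditions hold, these sums are all \<open>1 + R\<^sub>0\<close>; this bounds the loss from above, and it bounds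
  \<open>(m + 1) P(\<tau> > m)\<close>, so that the strategy stops almost surely (\<open>loss_le_if_near_optimal\<close>).
  Conversely a strategy with loss \<open>1 + R\<^sub>0\<close> has equality at every stage (\<open>stepwise_if_minimal\<close>).

  For the necessity it remains to see that the infimum of the loss is no larger than \<open>1 + R\<^sub>0\<close>, which
  requires near-optimal policies that are measurable. Here \<open>W\<close> is monotone and positively
  homogeneous with \<open>0 \<le> W \<le> l\<close>, so it grows at most at rate \<open>\<lambda>\<^sub>1\<close> in \<open>q\<close>, and the same is true after
  integration with any control. A control chosen for one value of the likelihood ratio \<open>q / p\<close> is
  thus nearly optimal for all slightly larger values, and countably many controls suffice
  (\<open>near_optimal_selector\<close>, \<open>minimal_loss\<close>).
\<close>

section \<open>The problem and the densities of a single response\<close>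

locale controlled_test = sigma_finite_measure M for M :: "'y measure" +
  fixes X :: "'x measure" and f0 f1 :: "'x \<Rightarrow> 'y \<Rightarrow> real" and lam0 lam1 :: real
  assumes dens0: "cond_density X M f0" and dens1: "cond_density X M f1"
    and lam0: "lam0 \<ge> 0" and lam1: "lam1 \<ge> 0" and X_ne: "space X \<noteq> {}"

lemma cond_density_measurable:
  assumes "cond_density X M f" "g \<in> measurable N X" "h \<in> measurable N M"
  shows "(\<lambda>z. f (g z) (h z)) \<in> borel_measurable N"
proof -
  have "case_prod f \<in> borel_measurable (X \<Otimes>\<^sub>M M)" using assms(1) by (simp add: cond_density_def)
  from measurable_compose[OF measurable_Pair[OF assms(2,3)] this] show ?thesis by simp
qed

lemma cond_density_nonneg: "cond_density X M f \<Longrightarrow> a \<in> space X \<Longrightarrow> z \<in> space M \<Longrightarrow> 0 \<le> f a z"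
  by (simp add: cond_density_def)

lemma cond_density_nn_integral:
  "cond_density X M f \<Longrightarrow> a \<in> space X \<Longrightarrow> (\<integral>\<^sup>+z. ennreal (f a z) \<partial>M) = 1"
  by (simp add: cond_density_def)

lemma cond_density_has_integral:
  assumes "cond_density X M f" "a \<in> space X"
  shows "has_bochner_integral M (f a) 1"
  using assms by (intro has_bochner_integral_nn_integral)
    (auto intro!: AE_I2 cond_density_measurable[OF assms(1)] simp: cond_density_nonneg cond_density_nn_integral)

lemmas cond_density_integrable = integrable.intros[OF cond_density_has_integral]
lemmas cond_density_integral = has_bochner_integral_integral_eq[OF cond_density_has_integral]

section \<open>Value functions of two joint densities\<close>

context controlled_test
begin

definition min_risk :: "real \<Rightarrow> real \<Rightarrow> real" where
  "min_risk p q = min (lam0 * p) (lam1 * q)"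

text \<open>
  The continuation values of the problem are functions of the pair \<open>(p, q)\<close> of joint densities of
  the data so far. If \<open>v\<close> is such a function for the next stage, \<open>next_value v a p q\<close> is its
  \<open>\<mu>\<close>-integral when control \<open>a\<close> is applied now: the new response multiplies the two densities by
  \<open>f0 a z\<close> and \<open>f1 a z\<close>.
\<close>

definition next_value :: "(real \<Rightarrow> real \<Rightarrow> real) \<Rightarrow> 'x \<Rightarrow> real \<Rightarrow> real \<Rightarrow> real" where
  "next_value v a p q = (\<integral>z. v (p * f0 a z) (q * f1 a z) \<partial>M)"

definition best_next :: "(real \<Rightarrow> real \<Rightarrow> real) \<Rightarrow> real \<Rightarrow> real \<Rightarrow> real" where
  "best_next v p q = (INF a\<in>space X. next_value v a p q)"

definition step :: "(real \<Rightarrow> real \<Rightarrow> real) \<Rightarrow> real \<Rightarrow> real \<Rightarrow> real" where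
  "step v p q = min (min_risk p q) (p + best_next v p q)"

text \<open>
  \<open>horizon_value n\<close> is the common value of all \<open>V\<^sub>k\<^sup>N\<close> with \<open>N - k = n\<close> as a function of the two
  joint densities, and \<open>limit_value\<close> is that of all \<open>V\<^sub>k\<close>.
\<close>

primrec horizon_value :: "nat \<Rightarrow> real \<Rightarrow> real \<Rightarrow> real" where
  "horizon_value 0 = min_risk"
| "horizon_value (Suc n) = step (horizon_value n)"

definition limit_value :: "real \<Rightarrow> real \<Rightarrow> real" where
  "limit_value p q = (INF n. horizon_value n p q)"

text \<open>
  The properties of \<open>min_risk\<close> that survive the dynamic programming step and pointwise limits.
  Monotonicity and positive homogeneity together bound the growth of \<open>v\<close>, which is the source of
  continuity, hence of measurability, and of near-optimal measurable policies.
\<close>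

definition risk_like :: "(real \<Rightarrow> real \<Rightarrow> real) \<Rightarrow> bool" where
  "risk_like v \<longleftrightarrow>
     (\<forall>p\<ge>0. \<forall>q\<ge>0. 0 \<le> v p q \<and> v p q \<le> min_risk p q) \<and>
     (\<forall>p\<ge>0. \<forall>q\<ge>0. \<forall>p'\<ge>p. \<forall>q'\<ge>q. v p q \<le> v p' q') \<and>
     (\<forall>p\<ge>0. \<forall>q\<ge>0. \<forall>c>0. v (c * p) (c * q) = c * v p q)"

lemma risk_likeI:
  assumes "\<And>p q. 0 \<le> p \<Longrightarrow> 0 \<le> q \<Longrightarrow> 0 \<le> v p q"
    and "\<And>p q. 0 \<le> p \<Longrightarrow> 0 \<le> q \<Longrightarrow> v p q \<le> min_risk p q"
    and "\<And>p q p' q'. 0 \<le> p \<Longrightarrow> 0 \<le> q \<Longrightarrow> p \<le> p' \<Longrightarrow> q \<le> q' \<Longrightarrow> v p q \<le> v p' q'"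
    and "\<And>p q c. 0 \<le> p \<Longrightarrow> 0 \<le> q \<Longrightarrow> 0 < c \<Longrightarrow> v (c * p) (c * q) = c * v p q"
  shows "risk_like v"
  unfolding risk_like_def by (intro conjI allI impI) (simp_all add: assms)

lemma risk_like_nonneg: "risk_like v \<Longrightarrow> 0 \<le> p \<Longrightarrow> 0 \<le> q \<Longrightarrow> 0 \<le> v p q"
  and risk_like_le: "risk_like v \<Longrightarrow> 0 \<le> p \<Longrightarrow> 0 \<le> q \<Longrightarrow> v p q \<le> min_risk p q"
  and risk_like_mono:
    "risk_like v \<Longrightarrow> 0 \<le> p \<Longrightarrow> 0 \<le> q \<Longrightarrow> p \<le> p' \<Longrightarrow> q \<le> q' \<Longrightarrow> v p q \<le> v p' q'"
  and risk_like_scale: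
    "risk_like v \<Longrightarrow> 0 \<le> p \<Longrightarrow> 0 \<le> q \<Longrightarrow> 0 < c \<Longrightarrow> v (c * p) (c * q) = c * v p q"
  unfolding risk_like_def by simp_all

lemma risk_like_le0: "risk_like v \<Longrightarrow> 0 \<le> p \<Longrightarrow> 0 \<le> q \<Longrightarrow> v p q \<le> lam0 * p"
  and risk_like_le1: "risk_like v \<Longrightarrow> 0 \<le> p \<Longrightarrow> 0 \<le> q \<Longrightarrow> v p q \<le> lam1 * q"
  using risk_like_le[of v p q] by (auto simp: min_risk_def)

lemma risk_like_min_risk: "risk_like min_risk"
proof (rule risk_likeI)
  fix p q c :: real assume "0 \<le> p" "0 \<le> q" "0 < c"
  then show "min_risk (c * p) (c * q) = c * min_risk p q"
    by (simp add: min_risk_def min_mult_distrib_left mult.left_commute)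
next
  fix p q p' q' :: real assume "p \<le> p'" "q \<le> q'"
  then show "min_risk p q \<le> min_risk p' q'"
    using lam0 lam1 unfolding min_risk_def by (intro min.mono mult_left_mono)
qed (use lam0 lam1 in \<open>auto simp: min_risk_def\<close>)

text \<open>
  Raising \<open>p\<close> to \<open>p + h = c * p\<close> costs at most raising both arguments by the factor \<open>c = 1 + h / p\<close>,
  and by homogeneity that costs exactly \<open>(h / p) * v p q\<close>, where \<open>v p q \<le> lam0 * p\<close>.
\<close>

lemma risk_like_incr0:
  assumes v: "risk_like v" and "0 \<le> p" "0 \<le> q" "0 \<le> h"
  shows "v (p + h) q \<le> v p q + lam0 * h"
proof (cases "p = 0")
  case True
  then show ?thesis
    using risk_like_le0[OF v, of h q] risk_like_nonneg[OF v, of 0 q] assms by simp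
next
  case False
  define c where "c = 1 + h / p"
  have c: "c \<ge> 1" "c * p = p + h" using False assms by (auto simp: c_def field_simps)
  have "v (p + h) q \<le> v (c * p) (c * q)"
    using c assms mult_right_mono[of 1 c q] by (intro risk_like_mono[OF v]) auto
  also have "\<dots> = c * v p q"
    using c(1) assms by (intro risk_like_scale[OF v]) auto
  also have "\<dots> = v p q + h / p * v p q"
    by (simp add: c_def algebra_simps)
  also have "h / p * v p q \<le> h / p * (lam0 * p)"
    using assms by (intro mult_left_mono risk_like_le0[OF v]) auto
  finally show ?thesis using False by (simp add: mult.commute)
qed

lemma risk_like_incr1:
  assumes v: "risk_like v" and "0 \<le> p" "0 \<le> q" "0 \<le> h"
  shows "v p (q + h) \<le> v p q + lam1 * h"
proof (cases "q = 0")
  case True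
  then show ?thesis
    using risk_like_le1[OF v, of p h] risk_like_nonneg[OF v, of p 0] assms by simp
next
  case False
  define c where "c = 1 + h / q"
  have c: "c \<ge> 1" "c * q = q + h" using False assms by (auto simp: c_def field_simps)
  have "v p (q + h) \<le> v (c * p) (c * q)"
    using c assms mult_right_mono[of 1 c p] by (intro risk_like_mono[OF v]) auto
  also have "\<dots> = c * v p q"
    using c(1) assms by (intro risk_like_scale[OF v]) auto
  also have "\<dots> = v p q + h / q * v p q"
    by (simp add: c_def algebra_simps)
  also have "h / q * v p q \<le> h / q * (lam1 * q)"
    using assms by (intro mult_left_mono risk_like_le1[OF v]) auto
  finally show ?thesis using False by (simp add: mult.commute)
qed

lemma risk_like_lipschitz:
  assumes v: "risk_like v" and "0 \<le> p" "0 \<le> q" "0 \<le> p'" "0 \<le> q'"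
  shows "\<bar>v p q - v p' q'\<bar> \<le> lam0 * \<bar>p - p'\<bar> + lam1 * \<bar>q - q'\<bar>"
proof -
  have *: "v p q \<le> v p' q' + lam0 * \<bar>p - p'\<bar> + lam1 * \<bar>q - q'\<bar>"
    if "0 \<le> p" "0 \<le> q" "0 \<le> p'" "0 \<le> q'" for p q p' q'
  proof -
    have "v p q \<le> v (p' + \<bar>p - p'\<bar>) (q' + \<bar>q - q'\<bar>)"
      using that by (intro risk_like_mono[OF v]) auto
    also have "\<dots> \<le> v (p' + \<bar>p - p'\<bar>) q' + lam1 * \<bar>q - q'\<bar>"
      using that by (intro risk_like_incr1[OF v]) auto
    also have "v (p' + \<bar>p - p'\<bar>) q' \<le> v p' q' + lam0 * \<bar>p - p'\<bar>"
      using that by (intro risk_like_incr0[OF v]) auto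
    finally show ?thesis by simp
  qed
  from *[of p q p' q'] *[of p' q' p q] assms show ?thesis
    by (simp add: abs_minus_commute)
qed

text \<open>
  The truncation at \<open>0\<close> extends \<open>v\<close> from the quadrant, where alone it is controlled, to a
  continuous function on the plane.
\<close>

lemma risk_like_measurable:
  assumes v: "risk_like v" and [measurable]: "g \<in> borel_measurable N" "h \<in> borel_measurable N"
    and nonneg: "\<And>z. z \<in> space N \<Longrightarrow> 0 \<le> g z" "\<And>z. z \<in> space N \<Longrightarrow> 0 \<le> h z"
  shows "(\<lambda>z. v (g z) (h z)) \<in> borel_measurable N"
proof -
  define u where "u = (\<lambda>x. v (max 0 (fst x)) (max 0 (snd x)))"
  have "continuous_on UNIV u"
  proof (rule continuous_at_imp_continuous_on, intro ballI, unfold isCont_def LIM_zero_iff[symmetric, of u])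
    fix x0 :: "real \<times> real"
    let ?b = "\<lambda>x. lam0 * \<bar>max 0 (fst x) - max 0 (fst x0)\<bar> + lam1 * \<bar>max 0 (snd x) - max 0 (snd x0)\<bar>"
    have "(?b \<longlongrightarrow> lam0 * \<bar>max 0 (fst x0) - max 0 (fst x0)\<bar> + lam1 * \<bar>max 0 (snd x0) - max 0 (snd x0)\<bar>) (at x0)"
      by (intro tendsto_intros)
    then have b: "(?b \<longlongrightarrow> 0) (at x0)" by simp
    show "((\<lambda>x. u x - u x0) \<longlongrightarrow> 0) (at x0)"
      by (rule Lim_null_comparison[OF _ b])
        (auto simp: u_def intro!: always_eventually risk_like_lipschitz[OF v])
  qed
  then have [measurable]: "u \<in> borel_measurable borel" by (rule borel_measurable_continuous_onI)
  have "(\<lambda>z. u (g z, h z)) \<in> borel_measurable N" by measurable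
  also have "?this \<longleftrightarrow> ?thesis"
    using nonneg by (intro measurable_cong) (auto simp: u_def max_def)
  finally show ?thesis .
qed

lemma next_value_integrable:
  assumes v: "risk_like v" and a: "a \<in> space X" and "0 \<le> p" "0 \<le> q"
  shows "integrable M (\<lambda>z. v (p * f0 a z) (q * f1 a z))"
proof (rule Bochner_Integration.integrable_bound)
  show "integrable M (\<lambda>z. lam0 * (p * f0 a z))"
    using cond_density_integrable[OF dens0 a] by simp
  show "(\<lambda>z. v (p * f0 a z) (q * f1 a z)) \<in> borel_measurable M"
    using assms cond_density_integrable[OF dens0 a] cond_density_integrable[OF dens1 a]
    by (intro risk_like_measurable[OF v]) (auto simp: cond_density_nonneg[OF dens0] cond_density_nonneg[OF dens1])
  show "AE z in M. norm (v (p * f0 a z) (q * f1 a z)) \<le> norm (lam0 * (p * f0 a z))"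
  proof (intro AE_I2)
    fix z assume "z \<in> space M"
    then have "0 \<le> p * f0 a z" "0 \<le> q * f1 a z"
      using assms cond_density_nonneg[OF dens0] cond_density_nonneg[OF dens1] by auto
    then show "norm (v (p * f0 a z) (q * f1 a z)) \<le> norm (lam0 * (p * f0 a z))"
      using risk_like_le0[OF v] risk_like_nonneg[OF v] lam0 by simp
  qed
qed

lemma scaled_nonneg:
  assumes "a \<in> space X" "z \<in> space M" "0 \<le> p"
  shows "0 \<le> p * f0 a z" "0 \<le> p * f1 a z"
  using assms cond_density_nonneg[OF dens0] cond_density_nonneg[OF dens1] by auto

lemma risk_like_next_value:
  assumes v: "risk_like v" and a: "a \<in> space X"
  shows "risk_like (next_value v a)"
proof (rule risk_likeI)
  fix p q :: real assume pq: "0 \<le> p" "0 \<le> q"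
  show "0 \<le> next_value v a p q"
    unfolding next_value_def using pq a
    by (intro Bochner_Integration.integral_nonneg risk_like_nonneg[OF v] scaled_nonneg)
  have "next_value v a p q \<le> (\<integral>z. lam0 * (p * f0 a z) \<partial>M)"
    unfolding next_value_def using pq a cond_density_integrable[OF dens0 a]
    by (intro integral_mono next_value_integrable[OF v] risk_like_le0[OF v] scaled_nonneg) auto
  moreover have "next_value v a p q \<le> (\<integral>z. lam1 * (q * f1 a z) \<partial>M)"
    unfolding next_value_def using pq a cond_density_integrable[OF dens1 a]
    by (intro integral_mono next_value_integrable[OF v] risk_like_le1[OF v] scaled_nonneg) auto
  ultimately show "next_value v a p q \<le> min_risk p q"
    by (simp add: min_risk_def cond_density_integral[OF dens0 a] cond_density_integral[OF dens1 a])
  show "next_value v a (c * p) (c * q) = c * next_value v a p q" if "0 < c" for c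
  proof -
    have "next_value v a (c * p) (c * q) = (\<integral>z. c * v (p * f0 a z) (q * f1 a z) \<partial>M)"
      unfolding next_value_def
      using risk_like_scale[OF v scaled_nonneg(1)[OF a _ pq(1)] scaled_nonneg(2)[OF a _ pq(2)] that]
      by (intro Bochner_Integration.integral_cong) (auto simp: mult.assoc)
    then show ?thesis by (simp add: next_value_def)
  qed
  fix p' q' assume "p \<le> p'" "q \<le> q'"
  then show "next_value v a p q \<le> next_value v a p' q'"
    unfolding next_value_def using pq a
    by (intro integral_mono next_value_integrable[OF v] risk_like_mono[OF v] scaled_nonneg
          mult_right_mono cond_density_nonneg[OF dens0] cond_density_nonneg[OF dens1]) auto
qed

lemma best_next_le:
  assumes "risk_like v" "a \<in> space X" "0 \<le> p" "0 \<le> q"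
  shows "best_next v p q \<le> next_value v a p q"
  unfolding best_next_def using assms risk_like_nonneg[OF risk_like_next_value[OF assms(1)]]
  by (intro cINF_lower bdd_belowI2[where m = 0]) auto

lemma best_next_ge:
  assumes "\<And>a. a \<in> space X \<Longrightarrow> r \<le> next_value v a p q"
  shows "r \<le> best_next v p q"
  unfolding best_next_def using assms X_ne by (intro cINF_greatest) auto

lemma best_next_approx:
  assumes "0 < e"
  shows "\<exists>a\<in>space X. next_value v a p q \<le> best_next v p q + e"
proof (rule ccontr)
  assume "\<not> ?thesis"
  then have "best_next v p q + e \<le> best_next v p q"
    by (intro best_next_ge) force
  with assms show False by simp
qed

lemma best_next_mono:
  assumes u: "risk_like u" and v: "risk_like v" and pq: "0 \<le> p" "0 \<le> q" "p \<le> p'" "q \<le> q'"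
    and le: "\<And>p q. 0 \<le> p \<Longrightarrow> 0 \<le> q \<Longrightarrow> u p q \<le> v p q"
  shows "best_next u p q \<le> best_next v p' q'"
proof (rule best_next_ge)
  fix a assume a: "a \<in> space X"
  have "best_next u p q \<le> next_value u a p q" by (rule best_next_le[OF u a pq(1,2)])
  also have "\<dots> \<le> next_value v a p q"
    unfolding next_value_def using pq
    by (intro integral_mono next_value_integrable[OF u a] next_value_integrable[OF v a] le
          scaled_nonneg[OF a])
  also have "\<dots> \<le> next_value v a p' q'"
    by (rule risk_like_mono[OF risk_like_next_value[OF v a] pq])
  finally show "best_next u p q \<le> next_value v a p' q'" .
qed

text \<open>
  Only homogeneity needs an argument: one inequality is immediate from the definition of an infimum,
  and the other is the same inequality for the factor \<open>1 / c\<close>.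
\<close>

lemma risk_like_best_next:
  assumes v: "risk_like v"
  shows "risk_like (best_next v)"
proof (rule risk_likeI)
  obtain a0 where a0: "a0 \<in> space X" using X_ne by blast
  fix p q :: real assume pq: "0 \<le> p" "0 \<le> q"
  show "0 \<le> best_next v p q"
    by (rule best_next_ge) (rule risk_like_nonneg[OF risk_like_next_value[OF v] pq])
  show "best_next v p q \<le> min_risk p q"
    using best_next_le[OF v a0 pq] risk_like_le[OF risk_like_next_value[OF v a0] pq] by simp
  show "best_next v p q \<le> best_next v p' q'" if "p \<le> p'" "q \<le> q'" for p' q'
    by (rule best_next_mono[OF v v pq that]) simp
  have *: "c * best_next v p q \<le> best_next v (c * p) (c * q)" if "0 < c" "0 \<le> p" "0 \<le> q" for c p q
    using that by (intro best_next_ge)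
      (simp add: risk_like_scale[OF risk_like_next_value[OF v]] best_next_le[OF v])
  fix c :: real assume c: "0 < c"
  have "(1 / c) * best_next v (c * p) (c * q) \<le> best_next v (1 / c * (c * p)) (1 / c * (c * q))"
    using c pq by (intro *) auto
  then have "best_next v (c * p) (c * q) \<le> c * best_next v p q"
    using c by (simp add: field_simps)
  with *[OF c pq] show "best_next v (c * p) (c * q) = c * best_next v p q" by simp
qed

lemma risk_like_step:
  assumes v: "risk_like v"
  shows "risk_like (step v)"
proof (rule risk_likeI)
  note b = risk_like_best_next[OF v]
  fix p q :: real assume pq: "0 \<le> p" "0 \<le> q"
  show "0 \<le> step v p q"
    using risk_like_nonneg[OF b pq] risk_like_nonneg[OF risk_like_min_risk pq] pq by (simp add: step_def)
  show "step v p q \<le> min_risk p q" by (simp add: step_def)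
  show "step v p q \<le> step v p' q'" if "p \<le> p'" "q \<le> q'" for p' q'
    unfolding step_def
    by (intro min.mono add_mono that risk_like_mono[OF b pq] risk_like_mono[OF risk_like_min_risk pq])
  show "step v (c * p) (c * q) = c * step v p q" if c: "0 < c" for c
    using c by (simp add: step_def risk_like_scale[OF b pq c] risk_like_scale[OF risk_like_min_risk pq c]
      min_mult_distrib_left distrib_left)
qed

lemma risk_like_horizon_value: "risk_like (horizon_value n)"
  by (induction n) (auto intro: risk_like_min_risk risk_like_step)

lemma horizon_value_Suc_le:
  assumes "0 \<le> p" "0 \<le> q"
  shows "horizon_value (Suc n) p q \<le> horizon_value n p q"
  using assms
proof (induction n arbitrary: p q)
  case 0
  then show ?case by (simp add: step_def)
next
  case (Suc n)
  have *: "best_next (horizon_value (Suc n)) p q \<le> best_next (horizon_value n) p q"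
    using Suc.prems Suc.IH by (intro best_next_mono risk_like_horizon_value) simp_all
  have "step (horizon_value (Suc n)) p q \<le> step (horizon_value n) p q"
    unfolding step_def by (intro min.mono add_mono order_refl *)
  then show ?case by simp
qed

lemma horizon_value_decseq: "0 \<le> p \<Longrightarrow> 0 \<le> q \<Longrightarrow> decseq (\<lambda>n. horizon_value n p q)"
  by (rule decseq_SucI) (rule horizon_value_Suc_le)

lemma horizon_value_bdd: "0 \<le> p \<Longrightarrow> 0 \<le> q \<Longrightarrow> bdd_below (range (\<lambda>n. horizon_value n p q))"
  by (intro bdd_belowI2[where m = 0] risk_like_nonneg[OF risk_like_horizon_value])

lemma horizon_value_tendsto:
  assumes "0 \<le> p" "0 \<le> q"
  shows "(\<lambda>n. horizon_value n p q) \<longlonglongrightarrow> limit_value p q"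
  unfolding limit_value_def
  by (rule LIMSEQ_decseq_INF[OF horizon_value_bdd horizon_value_decseq]) (use assms in auto)

lemma limit_value_le: "0 \<le> p \<Longrightarrow> 0 \<le> q \<Longrightarrow> limit_value p q \<le> horizon_value n p q"
  unfolding limit_value_def by (intro cINF_lower horizon_value_bdd) auto

lemma risk_like_limit_value: "risk_like limit_value"
proof (rule risk_likeI)
  note h = risk_like_horizon_value
  fix p q :: real assume pq: "0 \<le> p" "0 \<le> q"
  note lim = horizon_value_tendsto[OF pq]
  show "0 \<le> limit_value p q"
    using lim by (rule LIMSEQ_le_const) (use risk_like_nonneg[OF h pq] in auto)
  show "limit_value p q \<le> min_risk p q"
    using lim by (rule LIMSEQ_le_const2) (use risk_like_le[OF h pq] in auto)
  show "limit_value p q \<le> limit_value p' q'" if "p \<le> p'" "q \<le> q'" for p' q'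
    using risk_like_mono[OF h pq that] pq that
    by (intro LIMSEQ_le[OF lim horizon_value_tendsto]) auto
  fix c :: real assume c: "0 < c"
  have "(\<lambda>n. horizon_value n (c * p) (c * q)) \<longlonglongrightarrow> c * limit_value p q"
    unfolding risk_like_scale[OF h pq c] by (intro tendsto_intros lim)
  moreover have "(\<lambda>n. horizon_value n (c * p) (c * q)) \<longlonglongrightarrow> limit_value (c * p) (c * q)"
    using pq c by (intro horizon_value_tendsto) auto
  ultimately show "limit_value (c * p) (c * q) = c * limit_value p q"
    using LIMSEQ_unique by blast
qed

lemma next_value_tendsto:
  assumes a: "a \<in> space X" and pq: "0 \<le> p" "0 \<le> q"
  shows "(\<lambda>n. next_value (horizon_value n) a p q) \<longlonglongrightarrow> next_value limit_value a p q"
  unfolding next_value_def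
proof (rule integral_dominated_convergence)
  show "integrable M (\<lambda>z. min_risk (p * f0 a z) (q * f1 a z))"
    by (rule next_value_integrable[OF risk_like_min_risk a pq])
  show "(\<lambda>z. limit_value (p * f0 a z) (q * f1 a z)) \<in> borel_measurable M"
    using next_value_integrable[OF risk_like_limit_value a pq] by auto
  show "(\<lambda>z. horizon_value n (p * f0 a z) (q * f1 a z)) \<in> borel_measurable M" for n
    using next_value_integrable[OF risk_like_horizon_value a pq] by auto
  show "AE z in M. (\<lambda>n. horizon_value n (p * f0 a z) (q * f1 a z))
          \<longlonglongrightarrow> limit_value (p * f0 a z) (q * f1 a z)"
    using pq by (intro AE_I2 horizon_value_tendsto scaled_nonneg[OF a])
  show "AE z in M. norm (horizon_value n (p * f0 a z) (q * f1 a z))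
          \<le> min_risk (p * f0 a z) (q * f1 a z)" for n
    using pq a risk_like_nonneg[OF risk_like_horizon_value] risk_like_le[OF risk_like_horizon_value]
    by (intro AE_I2) (simp add: scaled_nonneg)
qed

text \<open>
  For each control the integral passes to the limit by dominated convergence. Infimum over the
  controls and decreasing limit in the horizon are both infima, so they commute.
\<close>

lemma best_next_tendsto:
  assumes pq: "0 \<le> p" "0 \<le> q"
  shows "(\<lambda>n. best_next (horizon_value n) p q) \<longlonglongrightarrow> best_next limit_value p q"
proof -
  let ?r = "\<lambda>n. best_next (horizon_value n) p q"
  have ge: "best_next limit_value p q \<le> ?r n" for n
    using pq by (intro best_next_mono risk_like_limit_value risk_like_horizon_value limit_value_le) auto
  have "decseq ?r"
    using pq by (intro decseq_SucI best_next_mono risk_like_horizon_value horizon_value_Suc_le) auto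
  then obtain r where r: "?r \<longlonglongrightarrow> r"
    using ge decseq_convergent[of ?r "best_next limit_value p q"] by blast
  have "r \<le> best_next limit_value p q"
  proof (rule best_next_ge)
    fix a assume a: "a \<in> space X"
    show "r \<le> next_value limit_value a p q"
      using best_next_le[OF risk_like_horizon_value a pq]
      by (intro LIMSEQ_le[OF r next_value_tendsto[OF a pq]]) auto
  qed
  moreover have "best_next limit_value p q \<le> r"
    using r by (rule LIMSEQ_le_const) (use ge in auto)
  ultimately show ?thesis using r by simp
qed

text \<open>
  The optimality equation \<open>V\<^sub>k = min {l\<^sub>k, f\<^sup>k + R\<^sub>k}\<close> for the infinite horizon.
\<close>

lemma limit_value_eq:
  assumes pq: "0 \<le> p" "0 \<le> q"
  shows "limit_value p q = min (min_risk p q) (p + best_next limit_value p q)"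
proof (rule LIMSEQ_unique)
  show "(\<lambda>n. horizon_value (Suc n) p q) \<longlonglongrightarrow> limit_value p q"
    by (rule LIMSEQ_Suc[OF horizon_value_tendsto[OF pq]])
  show "(\<lambda>n. horizon_value (Suc n) p q) \<longlonglongrightarrow> min (min_risk p q) (p + best_next limit_value p q)"
    unfolding horizon_value.simps step_def by (intro tendsto_intros best_next_tendsto[OF pq])
qed

end

section \<open>Control sequences generated by a policy\<close>

lemma restrict_seq_space: "y \<in> space (seq_space M n) \<Longrightarrow> restrict y {1..n} = y"
  by (auto simp: space_PiM PiE_def intro: extensional_restrict)

lemma upd_in_seq_space:
  "y \<in> space (seq_space M n) \<Longrightarrow> z \<in> space M \<Longrightarrow> y(Suc n := z) \<in> space (seq_space M (Suc n))"
  by (auto simp: space_PiM PiE_def extensional_def Pi_iff le_Suc_eq)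

lemma seq_space_Suc: "seq_space M (Suc n) = Pi\<^sub>M (insert (Suc n) {1..n}) (\<lambda>_. M)"
  by (rule arg_cong[where f = "\<lambda>I. Pi\<^sub>M I (\<lambda>_. M)"]) auto

lemma restrict_measurable_seq_space:
  "n \<le> m \<Longrightarrow> (\<lambda>y. restrict y {1..n}) \<in> measurable (seq_space M m) (seq_space M n)"
  by (rule measurable_restrict_subset) auto

lemma joint_density_0 [simp]: "joint_density f 0 x y = 1"
  by (simp add: joint_density_def)

lemma joint_density_upd:
  "joint_density f (Suc n) (x(Suc n := a)) (y(Suc n := z)) = joint_density f n x y * f a z"
  by (simp add: joint_density_def)

lemma joint_density_nonneg:
  assumes "cond_density X M f" "x \<in> space (seq_space X n)" "y \<in> space (seq_space M n)"
  shows "0 \<le> joint_density f n x y"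
  unfolding joint_density_def using assms(2,3)
  by (intro prod_nonneg ballI cond_density_nonneg[OF assms(1)]) (auto simp: space_PiM)

lemma joint_density_measurable:
  assumes f: "cond_density X M f"
    and g: "g \<in> measurable N (seq_space X n)" and h: "h \<in> measurable N (seq_space M n)"
  shows "(\<lambda>w. joint_density f n (g w) (h w)) \<in> borel_measurable N"
  unfolding joint_density_def
proof (intro borel_measurable_prod cond_density_measurable[OF f])
  fix i assume i: "i \<in> {1..n}"
  show "(\<lambda>w. g w i) \<in> measurable N X"
    by (rule measurable_compose[OF g measurable_component_singleton[OF i]])
  show "(\<lambda>w. h w i) \<in> measurable N M"
    by (rule measurable_compose[OF h measurable_component_singleton[OF i]])
qed

definition next_control :: "('x, 'y) policy \<Rightarrow> nat \<Rightarrow> (nat \<Rightarrow> 'y) \<Rightarrow> 'x" where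
  "next_control \<xi> n y = \<xi> (Suc n) (controls \<xi> y n) (restrict y {1..n})"

lemma controls_cong:
  "(\<And>i. i \<in> {1..n} \<Longrightarrow> y i = y' i) \<Longrightarrow> controls \<xi> y n = controls \<xi> y' n"
proof (induction n)
  case (Suc n)
  then have "controls \<xi> y n = controls \<xi> y' n" "restrict y {1..n} = restrict y' {1..n}"
    by (auto simp: restrict_def fun_eq_iff)
  then show ?case by simp
qed simp

lemma along_upd: "i \<le> n \<Longrightarrow> along \<xi> F i (y(Suc n := z)) = along \<xi> F i y"
  unfolding along_def by (rule arg_cong2[where f = "F i"]) (auto intro: controls_cong)

lemma continue_prob_upd: "continue_prob \<xi> \<psi> n (y(Suc n := z)) = continue_prob \<xi> \<psi> n y"
  unfolding continue_prob_def by (intro prod.cong) (auto simp: along_upd)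

lemma continue_prob_0 [simp]: "continue_prob \<xi> \<psi> 0 y = 1"
  by (simp add: continue_prob_def)

lemma continue_prob_Suc:
  "continue_prob \<xi> \<psi> (Suc n) y = continue_prob \<xi> \<psi> n y * (1 - along \<xi> \<psi> (Suc n) y)"
  by (simp add: continue_prob_def)

lemma controls_upd:
  "controls \<xi> (y(Suc n := z)) (Suc n) = (controls \<xi> y n)(Suc n := next_control \<xi> n y)"
proof -
  have "controls \<xi> (y(Suc n := z)) n = controls \<xi> y n" by (rule controls_cong) auto
  moreover have "restrict (y(Suc n := z)) {1..n} = restrict y {1..n}" by auto
  ultimately show ?thesis by (simp add: next_control_def)
qed

lemma along_Suc_upd:
  assumes "y \<in> space (seq_space M n)" "z \<in> space M"
  shows "along \<xi> F (Suc n) (y(Suc n := z)) =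
     F (Suc n) ((controls \<xi> y n)(Suc n := next_control \<xi> n y)) (y(Suc n := z))"
  unfolding along_def controls_upd by (simp only: restrict_seq_space[OF upd_in_seq_space[OF assms]])

lemma along_joint_density_upd:
  assumes "y \<in> space (seq_space M n)" "z \<in> space M"
  shows "along \<xi> (joint_density f) (Suc n) (y(Suc n := z)) =
     along \<xi> (joint_density f) n y * f (next_control \<xi> n y) z"
  unfolding along_Suc_upd[OF assms] joint_density_upd
  unfolding along_def restrict_seq_space[OF assms(1)] ..

lemma controls_measurable:
  assumes \<xi>: "control_policy X M \<xi>" and "n \<le> m"
  shows "(\<lambda>y. controls \<xi> y n) \<in> measurable (seq_space M m) (seq_space X n)"
    and "next_control \<xi> n \<in> measurable (seq_space M m) X"
proof -
  have next_control: "next_control \<xi> n \<in> measurable (seq_space M m) X"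
    if "n \<le> m" "(\<lambda>y. controls \<xi> y n) \<in> measurable (seq_space M m) (seq_space X n)" for n
  proof -
    have \<xi>': "case_prod (\<xi> (Suc n)) \<in> measurable (seq_space X n \<Otimes>\<^sub>M seq_space M n) X"
      using \<xi> unfolding control_policy_def by force
    from measurable_compose[OF measurable_Pair[OF that(2) restrict_measurable_seq_space[OF that(1)]] this]
    show ?thesis by (simp add: next_control_def[abs_def])
  qed
  show *: "(\<lambda>y. controls \<xi> y n) \<in> measurable (seq_space M m) (seq_space X n)"
    using \<open>n \<le> m\<close>
  proof (induction n)
    case 0
    show ?case by (simp add: space_PiM)
  next
    case (Suc n)
    have "(\<lambda>y. (controls \<xi> y n)(Suc n := next_control \<xi> n y))
        \<in> measurable (seq_space M m) (seq_space X (Suc n))"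
      using Suc by (intro measurable_fun_upd[where J = "{1..n}"] next_control) auto
    then show ?case unfolding controls.simps next_control_def .
  qed
  show "next_control \<xi> n \<in> measurable (seq_space M m) X"
    by (rule next_control[OF assms(2) *])
qed

lemma along_measurable:
  assumes "control_policy X M \<xi>" "n \<le> m"
    and F: "case_prod (F n) \<in> borel_measurable (seq_space X n \<Otimes>\<^sub>M seq_space M n)"
  shows "along \<xi> F n \<in> borel_measurable (seq_space M m)"
  using measurable_compose[OF measurable_Pair[OF controls_measurable(1)[OF assms(1,2)]
          restrict_measurable_seq_space[OF assms(2)]] F]
  by (simp add: along_def[abs_def])

section \<open>The value functions depend on the data through two densities only\<close>

context controlled_test
begin

sublocale seq: product_sigma_finite "\<lambda>_::nat. M"
  by unfold_locales

lemma nn_integral_seq_space_Suc: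
  assumes "g \<in> borel_measurable (seq_space M (Suc n))"
  shows "(\<integral>\<^sup>+y. g y \<partial>seq_space M (Suc n)) = (\<integral>\<^sup>+y. \<integral>\<^sup>+z. g (y(Suc n := z)) \<partial>M \<partial>seq_space M n)"
  using assms unfolding seq_space_Suc by (intro seq.product_nn_integral_insert) auto

lemma nn_integral_seq_space_0: "(\<integral>\<^sup>+y. g y \<partial>seq_space M 0) = g (\<lambda>_. undefined)"
  by (simp add: seq.nn_integral_empty)

text \<open>
  A further stage changes the data \<open>(x, y)\<close> only by multiplying the two joint densities, so backward
  induction never needs more than the values of these densities.
\<close>

lemma V_trunc_eq:
  assumes "k \<le> N" "x \<in> space (seq_space X k)" "y \<in> space (seq_space M k)"
  shows "V_trunc X M f0 f1 lam0 lam1 N k x y =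
     horizon_value (N - k) (joint_density f0 k x y) (joint_density f1 k x y)"
  using assms
proof (induction "N - k" arbitrary: k x y)
  case 0
  then show ?case by (subst V_trunc.simps) (simp add: term_loss_def min_risk_def)
next
  case (Suc m)
  let ?p = "joint_density f0 k x y" and ?q = "joint_density f1 k x y"
  have m: "N - Suc k = m" "Suc k \<le> N" using Suc.hyps by auto
  have "next_integral M k (V_trunc X M f0 f1 lam0 lam1 N (Suc k)) x y a
      = next_value (horizon_value m) a ?p ?q" if a: "a \<in> space X" for a
    unfolding next_integral_def next_value_def
  proof (intro Bochner_Integration.integral_cong refl)
    fix z assume z: "z \<in> space M"
    show "V_trunc X M f0 f1 lam0 lam1 N (Suc k) (x(Suc k := a)) (y(Suc k := z))
        = horizon_value m (?p * f0 a z) (?q * f1 a z)"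
      using Suc.hyps(1)[OF m(1)[symmetric] m(2) upd_in_seq_space[OF Suc.prems(2) a]
          upd_in_seq_space[OF Suc.prems(3) z]]
      by (simp only: m joint_density_upd)
  qed
  then have "min_next X M k (V_trunc X M f0 f1 lam0 lam1 N (Suc k)) x y
      = best_next (horizon_value m) ?p ?q"
    unfolding min_next_def best_next_def by (intro INF_cong) auto
  moreover have "N - k = Suc m" "k < N" using Suc.hyps by auto
  ultimately show ?case
    by (subst V_trunc.simps) (simp add: step_def term_loss_def min_risk_def)
qed

lemma V_lim_eq:
  assumes "x \<in> space (seq_space X k)" "y \<in> space (seq_space M k)"
  shows "V_lim X M f0 f1 lam0 lam1 k x y =
     limit_value (joint_density f0 k x y) (joint_density f1 k x y)"
  unfolding V_lim_def
proof (rule limI)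
  let ?p = "joint_density f0 k x y" and ?q = "joint_density f1 k x y"
  have "(\<lambda>n. horizon_value n ?p ?q) \<longlonglongrightarrow> limit_value ?p ?q"
    using assms by (intro horizon_value_tendsto joint_density_nonneg[OF dens0] joint_density_nonneg[OF dens1])
  then have "(\<lambda>n. V_trunc X M f0 f1 lam0 lam1 (n + k) k x y) \<longlonglongrightarrow> limit_value ?p ?q"
    using V_trunc_eq[OF _ assms] by simp
  then show "(\<lambda>N. V_trunc X M f0 f1 lam0 lam1 N k x y) \<longlonglongrightarrow> limit_value ?p ?q"
    by (rule LIMSEQ_offset)
qed

lemma R_lim_eq:
  assumes "x \<in> space (seq_space X k)" "y \<in> space (seq_space M k)"
  shows "R_lim X M f0 f1 lam0 lam1 k x y =
     best_next limit_value (joint_density f0 k x y) (joint_density f1 k x y)"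
  unfolding R_lim_def min_next_def best_next_def next_integral_def next_value_def
  by (intro INF_cong Bochner_Integration.integral_cong refl)
    (simp add: V_lim_eq[OF upd_in_seq_space[OF assms(1)] upd_in_seq_space[OF assms(2)]] joint_density_upd)

end

section \<open>The risks of a strategy, stage by stage\<close>

text \<open>
  Turns equality of total risks into almost everywhere equality of integrands: the difference of the
  integrands is nonnegative and has integral \<open>0\<close>.
\<close>

lemma nn_integral_eq_imp_AE_eq:
  fixes f g :: "'a \<Rightarrow> real"
  assumes [measurable]: "f \<in> borel_measurable N" "g \<in> borel_measurable N"
    and le: "\<And>x. x \<in> space N \<Longrightarrow> 0 \<le> f x \<and> f x \<le> g x"
    and eq: "(\<integral>\<^sup>+x. ennreal (g x) \<partial>N) \<le> (\<integral>\<^sup>+x. ennreal (f x) \<partial>N)"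
    and fin: "(\<integral>\<^sup>+x. ennreal (g x) \<partial>N) < \<infinity>"
  shows "AE x in N. f x = g x"
proof -
  have mono: "(\<integral>\<^sup>+x. ennreal (f x) \<partial>N) \<le> (\<integral>\<^sup>+x. ennreal (g x) \<partial>N)"
    using le by (intro nn_integral_mono) (auto intro!: ennreal_leI)
  have "(\<integral>\<^sup>+x. ennreal (g x) - ennreal (f x) \<partial>N) = (\<integral>\<^sup>+x. ennreal (g x) \<partial>N) - (\<integral>\<^sup>+x. ennreal (f x) \<partial>N)"
    using mono fin le by (intro nn_integral_diff) (auto intro!: ennreal_leI)
  also have "\<dots> = 0" using eq mono fin by (simp add: antisym)
  finally have "AE x in N. ennreal (g x) - ennreal (f x) = 0"
    by (subst (asm) nn_integral_0_iff_AE) auto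
  then show ?thesis
  proof (rule AE_mp[OF _ AE_I2], intro impI)
    fix x assume x: "x \<in> space N" and "ennreal (g x) - ennreal (f x) = 0"
    then have "ennreal (g x - f x) = 0" using le[OF x] by (simp add: ennreal_minus)
    then show "f x = g x" using le[OF x] by (simp add: ennreal_eq_0_iff)
  qed
qed

locale test_strategy = controlled_test M X f0 f1 lam0 lam1
  for M :: "'y measure" and X :: "'x measure" and f0 f1 lam0 lam1 +
  fixes \<xi> :: "('x, 'y) policy" and \<psi> :: "('x, 'y) stage_fun"
  assumes policy: "control_policy X M \<xi>" and rule: "stopping_rule X M \<psi>"
begin

text \<open>
  \<open>dens n\<close> and \<open>alt n\<close> are the joint densities of the first \<open>n\<close> responses under the hypothesis
  \<open>\<theta>\<^sub>0\<close> and the alternative \<open>\<theta>\<^sub>1\<close>, and \<open>future (dens n y) (alt n y)\<close> is \<open>R\<^sub>n\<close> along the policy.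
\<close>

abbreviation dens :: "nat \<Rightarrow> (nat \<Rightarrow> 'y) \<Rightarrow> real" where "dens \<equiv> along \<xi> (joint_density f0)"
abbreviation alt :: "nat \<Rightarrow> (nat \<Rightarrow> 'y) \<Rightarrow> real" where "alt \<equiv> along \<xi> (joint_density f1)"
abbreviation cont :: "nat \<Rightarrow> (nat \<Rightarrow> 'y) \<Rightarrow> real" where "cont \<equiv> continue_prob \<xi> \<psi>"
abbreviation future :: "real \<Rightarrow> real \<Rightarrow> real" where "future \<equiv> best_next limit_value"

lemma controls_in_space: "y \<in> space (seq_space M n) \<Longrightarrow> controls \<xi> y n \<in> space (seq_space X n)"
  using measurable_space[OF controls_measurable(1)[OF policy order_refl]] by auto

lemma next_control_in_space: "y \<in> space (seq_space M n) \<Longrightarrow> next_control \<xi> n y \<in> space X"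
  using measurable_space[OF controls_measurable(2)[OF policy order_refl]] by auto

lemma dens_nonneg: "y \<in> space (seq_space M n) \<Longrightarrow> 0 \<le> dens n y"
  and alt_nonneg: "y \<in> space (seq_space M n) \<Longrightarrow> 0 \<le> alt n y"
  using joint_density_nonneg[OF dens0 controls_in_space] joint_density_nonneg[OF dens1 controls_in_space]
  by (simp_all only: along_def restrict_seq_space)

lemma dens_measurable [measurable]: "dens n \<in> borel_measurable (seq_space M n)"
  and alt_measurable [measurable]: "alt n \<in> borel_measurable (seq_space M n)"
  unfolding along_def[abs_def]
  by (intro joint_density_measurable[OF dens0] joint_density_measurable[OF dens1]
      controls_measurable(1)[OF policy] restrict_measurable_seq_space order_refl)+

lemma along_psi_measurable [measurable]:
  "1 \<le> i \<Longrightarrow> i \<le> n \<Longrightarrow> along \<xi> \<psi> i \<in> borel_measurable (seq_space M n)"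
  using rule by (intro along_measurable[OF policy]) (auto simp: stopping_rule_def)

lemma along_psi_bounds:
  assumes "y \<in> space (seq_space M n)" "1 \<le> i" "i \<le> n"
  shows "0 \<le> along \<xi> \<psi> i y" "along \<xi> \<psi> i y \<le> 1"
proof -
  have y: "restrict y {1..i} \<in> space (seq_space M i)"
    using measurable_space[OF restrict_measurable_seq_space[OF assms(3)] assms(1)] .
  have "controls \<xi> y i \<in> space (seq_space X i)"
    using measurable_space[OF controls_measurable(1)[OF policy assms(3)] assms(1)] .
  with y rule assms(2) show "0 \<le> along \<xi> \<psi> i y" "along \<xi> \<psi> i y \<le> 1"
    by (auto simp: along_def stopping_rule_def)
qed

lemma cont_measurable [measurable]: "n \<le> m \<Longrightarrow> cont n \<in> borel_measurable (seq_space M m)"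
  unfolding continue_prob_def[abs_def]
  by (intro borel_measurable_prod borel_measurable_diff along_psi_measurable) auto

lemma cont_bounds:
  assumes "y \<in> space (seq_space M m)" "n \<le> m"
  shows "0 \<le> cont n y" "cont n y \<le> 1"
  unfolding continue_prob_def using along_psi_bounds[OF assms(1)] assms(2)
  by (auto intro!: prod_nonneg prod_le_1)

lemma V_along:
  assumes "y \<in> space (seq_space M n)"
  shows "along \<xi> (V_lim X M f0 f1 lam0 lam1) n y = limit_value (dens n y) (alt n y)"
    and "along \<xi> (R_lim X M f0 f1 lam0 lam1) n y = future (dens n y) (alt n y)"
    and "along \<xi> (term_loss f0 f1 lam0 lam1) n y = min_risk (dens n y) (alt n y)"
  using V_lim_eq[OF controls_in_space[OF assms] assms] R_lim_eq[OF controls_in_space[OF assms] assms]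
  by (simp_all only: along_def restrict_seq_space[OF assms] term_loss_def min_risk_def)

lemma next_integral_along:
  assumes "y \<in> space (seq_space M n)"
  shows "(\<integral>z. along \<xi> (V_lim X M f0 f1 lam0 lam1) (Suc n) (y(Suc n := z)) \<partial>M)
    = next_value limit_value (next_control \<xi> n y) (dens n y) (alt n y)"
  unfolding next_value_def
  by (intro Bochner_Integration.integral_cong refl)
    (simp only: V_along[OF upd_in_seq_space[OF assms]] along_joint_density_upd[OF assms])

abbreviation stp :: "nat \<Rightarrow> (nat \<Rightarrow> 'y) \<Rightarrow> real" where "stp \<equiv> stop_prob \<xi> \<psi>"
abbreviation chosen :: "nat \<Rightarrow> (nat \<Rightarrow> 'y) \<Rightarrow> real" where
  "chosen n y \<equiv> next_value limit_value (next_control \<xi> n y) (dens n y) (alt n y)"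

text \<open>
  \<open>stop_risk n\<close> is the \<open>n\<close>-th term of the loss. \<open>cont_risk n\<close> is the risk of the paths that
  continue after stage \<open>n\<close> if everything from then on is optimal; the sampling cost appears as
  \<open>n + 1\<close> because one more observation is certain. \<open>chosen_risk n\<close> is the same quantity when the
  next control is the one that the policy prescribes. \<open>survival n\<close> and \<open>stop_mass n\<close> are the
  probabilities under \<open>\<theta>\<^sub>0\<close> of \<open>\<tau> > n\<close> and of \<open>\<tau> = n\<close>.
\<close>

definition stop_risk :: "nat \<Rightarrow> ennreal" where
  "stop_risk n = (\<integral>\<^sup>+y. ennreal (stp n y * (real n * dens n y + min_risk (dens n y) (alt n y))) \<partial>seq_space M n)"

definition cont_risk :: "nat \<Rightarrow> ennreal" where
  "cont_risk n = (\<integral>\<^sup>+y. ennreal (cont n y * (real (Suc n) * dens n y + future (dens n y) (alt n y))) \<partial>seq_space M n)"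

definition chosen_risk :: "nat \<Rightarrow> ennreal" where
  "chosen_risk n = (\<integral>\<^sup>+y. ennreal (cont n y * (real (Suc n) * dens n y + chosen n y)) \<partial>seq_space M n)"

definition stop_mass :: "nat \<Rightarrow> ennreal" where
  "stop_mass n = (\<integral>\<^sup>+y. ennreal (stp n y * dens n y) \<partial>seq_space M n)"

definition survival :: "nat \<Rightarrow> ennreal" where
  "survival n = (\<integral>\<^sup>+y. ennreal (cont n y * dens n y) \<partial>seq_space M n)"

lemma stp_measurable [measurable]: "stp (Suc n) \<in> borel_measurable (seq_space M (Suc n))"
  unfolding stop_prob_def[abs_def]
  by (intro borel_measurable_times cont_measurable along_psi_measurable) auto

lemma stp_nonneg: "y \<in> space (seq_space M (Suc n)) \<Longrightarrow> 0 \<le> stp (Suc n) y"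
  using cont_bounds[of y "Suc n" n] along_psi_bounds[of y "Suc n" "Suc n"] by (simp add: stop_prob_def)

lemma stop_or_continue: "stp (Suc n) y + cont (Suc n) y = cont n y"
  by (simp add: stop_prob_def continue_prob_Suc algebra_simps)

lemma risk_measurable:
  "risk_like v \<Longrightarrow> (\<lambda>y. v (dens n y) (alt n y)) \<in> borel_measurable (seq_space M n)"
  by (rule risk_like_measurable[OF _ dens_measurable alt_measurable dens_nonneg alt_nonneg])

lemma risk_along_nonneg: "risk_like v \<Longrightarrow> y \<in> space (seq_space M n) \<Longrightarrow> 0 \<le> v (dens n y) (alt n y)"
  by (rule risk_like_nonneg[OF _ dens_nonneg alt_nonneg])

lemmas risk_like_future = risk_like_best_next[OF risk_like_limit_value]

lemmas [measurable] =
  risk_measurable[OF risk_like_min_risk] risk_measurable[OF risk_like_future]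
  risk_measurable[OF risk_like_limit_value]

lemma chosen_measurable [measurable]: "chosen n \<in> borel_measurable (seq_space M n)"
  unfolding next_value_def
proof (rule borel_measurable_lebesgue_integral)
  let ?N = "seq_space M n \<Otimes>\<^sub>M M"
  have c: "(\<lambda>w. next_control \<xi> n (fst w)) \<in> measurable ?N X"
    by (rule measurable_compose[OF measurable_fst controls_measurable(2)[OF policy order_refl]])
  have [measurable]: "(\<lambda>w. f0 (next_control \<xi> n (fst w)) (snd w)) \<in> borel_measurable ?N"
    by (rule cond_density_measurable[OF dens0 c measurable_snd])
  have [measurable]: "(\<lambda>w. f1 (next_control \<xi> n (fst w)) (snd w)) \<in> borel_measurable ?N"
    by (rule cond_density_measurable[OF dens1 c measurable_snd])
  have "(\<lambda>w. limit_value (dens n (fst w) * f0 (next_control \<xi> n (fst w)) (snd w))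
      (alt n (fst w) * f1 (next_control \<xi> n (fst w)) (snd w))) \<in> borel_measurable ?N"
  proof (intro risk_like_measurable[OF risk_like_limit_value])
    show "(\<lambda>w. dens n (fst w) * f0 (next_control \<xi> n (fst w)) (snd w)) \<in> borel_measurable ?N"
      "(\<lambda>w. alt n (fst w) * f1 (next_control \<xi> n (fst w)) (snd w)) \<in> borel_measurable ?N"
      by measurable
    fix w assume "w \<in> space ?N"
    then have w: "fst w \<in> space (seq_space M n)" "snd w \<in> space M" by (auto simp: space_pair_measure)
    show "0 \<le> dens n (fst w) * f0 (next_control \<xi> n (fst w)) (snd w)"
      "0 \<le> alt n (fst w) * f1 (next_control \<xi> n (fst w)) (snd w)"
      by (intro scaled_nonneg next_control_in_space dens_nonneg alt_nonneg w)+
  qed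
  then show "(\<lambda>(y, z). limit_value (dens n y * f0 (next_control \<xi> n y) z)
      (alt n y * f1 (next_control \<xi> n y) z)) \<in> borel_measurable ?N"
    by (simp add: case_prod_beta')
qed

lemma future_le_chosen:
  "y \<in> space (seq_space M n) \<Longrightarrow> future (dens n y) (alt n y) \<le> chosen n y"
  by (intro best_next_le risk_like_limit_value next_control_in_space dens_nonneg alt_nonneg)

lemma chosen_le: "y \<in> space (seq_space M n) \<Longrightarrow> chosen n y \<le> lam0 * dens n y"
  by (intro risk_like_le0 risk_like_next_value risk_like_limit_value next_control_in_space
      dens_nonneg alt_nonneg)

text \<open>
  Integrating out the last response, whose density under \<open>\<theta>\<^sub>0\<close> has integral \<open>1\<close>: the weight
  \<open>cont n\<close> does not depend on it.
\<close>

lemma nn_integral_next_stage: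
  assumes v: "risk_like v" and k: "0 \<le> k"
  shows "(\<integral>\<^sup>+y. ennreal (cont n y * (k * dens (Suc n) y + v (dens (Suc n) y) (alt (Suc n) y))) \<partial>seq_space M (Suc n))
    = (\<integral>\<^sup>+y. ennreal (cont n y * (k * dens n y + next_value v (next_control \<xi> n y) (dens n y) (alt n y))) \<partial>seq_space M n)"
proof -
  have [measurable]: "(\<lambda>y. v (dens (Suc n) y) (alt (Suc n) y)) \<in> borel_measurable (seq_space M (Suc n))"
    using v by (rule risk_measurable)
  have inner: "(\<integral>\<^sup>+z. ennreal (cont n y * (k * (dens n y * f0 (next_control \<xi> n y) z)
        + v (dens n y * f0 (next_control \<xi> n y) z) (alt n y * f1 (next_control \<xi> n y) z))) \<partial>M)
    = ennreal (cont n y * (k * dens n y + next_value v (next_control \<xi> n y) (dens n y) (alt n y)))"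
    if y: "y \<in> space (seq_space M n)" for y
  proof -
    let ?a = "next_control \<xi> n y"
    note a = next_control_in_space[OF y]
    note pq = dens_nonneg[OF y] alt_nonneg[OF y]
    note int = next_value_integrable[OF v a pq] cond_density_integrable[OF dens0 a]
    have nn: "0 \<le> cont n y * (k * (dens n y * f0 ?a z) + v (dens n y * f0 ?a z) (alt n y * f1 ?a z))"
      if "z \<in> space M" for z
    proof -
      note nn = scaled_nonneg(1)[OF a that pq(1)] scaled_nonneg(2)[OF a that pq(2)]
      have "0 \<le> v (dens n y * f0 ?a z) (alt n y * f1 ?a z)" by (rule risk_like_nonneg[OF v nn])
      moreover have "0 \<le> k * (dens n y * f0 ?a z)" using k nn(1) by (rule mult_nonneg_nonneg)
      ultimately show ?thesis
        using cont_bounds(1)[OF y order_refl] by simp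
    qed
    have int': "integrable M (\<lambda>z. cont n y * (k * (dens n y * f0 ?a z) + v (dens n y * f0 ?a z) (alt n y * f1 ?a z)))"
      using int by simp
    have "(\<integral>z. cont n y * (k * (dens n y * f0 ?a z) + v (dens n y * f0 ?a z) (alt n y * f1 ?a z)) \<partial>M)
        = cont n y * (k * dens n y + next_value v ?a (dens n y) (alt n y))"
      using int by (simp add: cond_density_integral[OF dens0 a] next_value_def)
    then show ?thesis
      by (subst nn_integral_eq_integral[OF int']) (auto intro!: AE_I2 nn)
  qed
  have "(\<lambda>y. ennreal (cont n y * (k * dens (Suc n) y + v (dens (Suc n) y) (alt (Suc n) y))))
      \<in> borel_measurable (seq_space M (Suc n))" by measurable
  then have "(\<integral>\<^sup>+y. ennreal (cont n y * (k * dens (Suc n) y + v (dens (Suc n) y) (alt (Suc n) y))) \<partial>seq_space M (Suc n))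
    = (\<integral>\<^sup>+y. \<integral>\<^sup>+z. ennreal (cont n (y(Suc n := z)) * (k * dens (Suc n) (y(Suc n := z))
        + v (dens (Suc n) (y(Suc n := z))) (alt (Suc n) (y(Suc n := z))))) \<partial>M \<partial>seq_space M n)"
    by (rule nn_integral_seq_space_Suc)
  also have "\<dots> = (\<integral>\<^sup>+y. \<integral>\<^sup>+z. ennreal (cont n y * (k * (dens n y * f0 (next_control \<xi> n y) z)
        + v (dens n y * f0 (next_control \<xi> n y) z) (alt n y * f1 (next_control \<xi> n y) z))) \<partial>M \<partial>seq_space M n)"
    by (intro nn_integral_cong) (simp only: continue_prob_upd along_joint_density_upd)
  also have "\<dots> = (\<integral>\<^sup>+y. ennreal (cont n y * (k * dens n y
        + next_value v (next_control \<xi> n y) (dens n y) (alt n y))) \<partial>seq_space M n)"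
    by (rule nn_integral_cong[OF inner])
  finally show ?thesis .
qed

lemma chosen_risk_eq:
  "chosen_risk n = (\<integral>\<^sup>+y. ennreal (cont n y * (real (Suc n) * dens (Suc n) y
      + limit_value (dens (Suc n) y) (alt (Suc n) y))) \<partial>seq_space M (Suc n))"
  unfolding chosen_risk_def by (rule nn_integral_next_stage[symmetric, OF risk_like_limit_value]) simp

lemma risk_like_zero: "risk_like (\<lambda>_ _. 0)"
  using lam0 lam1 by (auto simp: risk_like_def min_risk_def)

lemma survival_eq_next:
  "survival n = (\<integral>\<^sup>+y. ennreal (cont n y * dens (Suc n) y) \<partial>seq_space M (Suc n))"
  using nn_integral_next_stage[OF risk_like_zero, of 1 n] by (simp add: survival_def next_value_def)

lemma survival_Suc: "survival n = stop_mass (Suc n) + survival (Suc n)"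
proof -
  have "stop_mass (Suc n) + survival (Suc n)
      = (\<integral>\<^sup>+y. ennreal (stp (Suc n) y * dens (Suc n) y) + ennreal (cont (Suc n) y * dens (Suc n) y)
          \<partial>seq_space M (Suc n))"
    unfolding stop_mass_def survival_def by (rule nn_integral_add[symmetric]) measurable
  also have "\<dots> = survival n"
    unfolding survival_eq_next
  proof (intro nn_integral_cong)
    fix y assume y: "y \<in> space (seq_space M (Suc n))"
    show "ennreal (stp (Suc n) y * dens (Suc n) y) + ennreal (cont (Suc n) y * dens (Suc n) y)
        = ennreal (cont n y * dens (Suc n) y)"
      using stp_nonneg[OF y] dens_nonneg[OF y] cont_bounds[OF y order_refl]
      by (simp add: ennreal_plus[symmetric] distrib_right[symmetric] stop_or_continue del: ennreal_plus)
  qed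
  finally show ?thesis ..
qed

lemma dens_0 [simp]: "dens 0 y = 1" and alt_0 [simp]: "alt 0 y = 1"
  by (simp_all add: along_def)

lemma survival_le_1: "survival n \<le> 1"
proof (induction n)
  case 0
  then show ?case unfolding survival_def nn_integral_seq_space_0 by simp
next
  case (Suc n)
  have "survival (Suc n) \<le> survival n" unfolding survival_Suc[of n] by simp
  with Suc show ?case by simp
qed

lemma cont_risk_0: "cont_risk 0 = ennreal (1 + future 1 1)"
  unfolding cont_risk_def nn_integral_seq_space_0 by simp

lemma survival_le_cont_risk: "ennreal (real (Suc n)) * survival n \<le> cont_risk n"
proof -
  have "ennreal (real (Suc n)) * survival n
      = (\<integral>\<^sup>+y. ennreal (real (Suc n)) * ennreal (cont n y * dens n y) \<partial>seq_space M n)"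
    unfolding survival_def by (rule nn_integral_cmult[symmetric]) measurable
  also have "\<dots> \<le> cont_risk n"
    unfolding cont_risk_def
  proof (intro nn_integral_mono)
    fix y assume y: "y \<in> space (seq_space M n)"
    show "ennreal (real (Suc n)) * ennreal (cont n y * dens n y)
        \<le> ennreal (cont n y * (real (Suc n) * dens n y + future (dens n y) (alt n y)))"
      using dens_nonneg[OF y] cont_bounds[OF y order_refl] risk_along_nonneg[OF risk_like_future y]
      by (subst ennreal_mult[symmetric]) (auto intro!: ennreal_leI simp: algebra_simps)
  qed
  finally show ?thesis .
qed

lemma chosen_risk_le_survival: "chosen_risk n \<le> ennreal (real (Suc n) + lam0) * survival n"
proof -
  have "chosen_risk n \<le> (\<integral>\<^sup>+y. ennreal (real (Suc n) + lam0) * ennreal (cont n y * dens n y) \<partial>seq_space M n)"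
    unfolding chosen_risk_def
  proof (intro nn_integral_mono)
    fix y assume y: "y \<in> space (seq_space M n)"
    have "cont n y * (real (Suc n) * dens n y + chosen n y) \<le> cont n y * (real (Suc n) * dens n y + lam0 * dens n y)"
      using chosen_le[OF y] cont_bounds[OF y order_refl] by (intro mult_left_mono) auto
    also have "\<dots> = (real (Suc n) + lam0) * (cont n y * dens n y)" by (simp add: algebra_simps)
    finally show "ennreal (cont n y * (real (Suc n) * dens n y + chosen n y))
        \<le> ennreal (real (Suc n) + lam0) * ennreal (cont n y * dens n y)"
      using dens_nonneg[OF y] cont_bounds[OF y order_refl] lam0
      by (subst ennreal_mult[symmetric]) (auto intro!: ennreal_leI)
  qed
  also have "\<dots> = ennreal (real (Suc n) + lam0) * survival n"
    unfolding survival_def by (rule nn_integral_cmult) measurable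
  finally show ?thesis .
qed

lemma chosen_risk_finite: "chosen_risk n < \<infinity>"
proof -
  have "chosen_risk n \<le> ennreal (real (Suc n) + lam0) * 1"
    using chosen_risk_le_survival[of n] mult_left_mono[OF survival_le_1, of "ennreal (real (Suc n) + lam0)" n]
    by (rule order_trans) simp
  also have "\<dots> < \<infinity>" by simp
  finally show ?thesis .
qed

lemma cont_risk_le_chosen: "cont_risk n \<le> chosen_risk n"
  unfolding cont_risk_def chosen_risk_def
  using future_le_chosen cont_bounds[OF _ order_refl]
  by (intro nn_integral_mono ennreal_leI mult_left_mono) auto

lemma stop_mass_le: "k \<le> Suc n \<Longrightarrow> ennreal (real k) * stop_mass (Suc n) \<le> stop_risk (Suc n)"
proof -
  assume k: "k \<le> Suc n"
  have "ennreal (real k) * stop_mass (Suc n)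
      = (\<integral>\<^sup>+y. ennreal (real k) * ennreal (stp (Suc n) y * dens (Suc n) y) \<partial>seq_space M (Suc n))"
    unfolding stop_mass_def by (rule nn_integral_cmult[symmetric]) measurable
  also have "\<dots> \<le> stop_risk (Suc n)"
    unfolding stop_risk_def
  proof (intro nn_integral_mono)
    fix y assume y: "y \<in> space (seq_space M (Suc n))"
    let ?p = "dens (Suc n) y" and ?l = "min_risk (dens (Suc n) y) (alt (Suc n) y)"
    have "real k * (stp (Suc n) y * ?p) = stp (Suc n) y * (real k * ?p)" by simp
    also have "\<dots> \<le> stp (Suc n) y * (real (Suc n) * ?p + ?l)"
      using stp_nonneg[OF y] dens_nonneg[OF y] risk_along_nonneg[OF risk_like_min_risk y]
        mult_right_mono[of "real k" "real (Suc n)" ?p] k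
      by (intro mult_left_mono) auto
    finally show "ennreal (real k) * ennreal (stp (Suc n) y * ?p) \<le> ennreal (stp (Suc n) y * (real (Suc n) * ?p + ?l))"
      using stp_nonneg[OF y] dens_nonneg[OF y]
      by (subst ennreal_mult[symmetric]) (auto intro!: ennreal_leI)
  qed
  finally show ?thesis .
qed

text \<open>
  The integrand of \<open>stop_risk (n + 1) + cont_risk (n + 1)\<close>, to be compared with that of
  \<open>chosen_risk n\<close>.
\<close>

definition split_risk :: "nat \<Rightarrow> (nat \<Rightarrow> 'y) \<Rightarrow> real" where
  "split_risk n y = stp (Suc n) y * (real (Suc n) * dens (Suc n) y + min_risk (dens (Suc n) y) (alt (Suc n) y))
     + cont (Suc n) y * (real (Suc (Suc n)) * dens (Suc n) y + future (dens (Suc n) y) (alt (Suc n) y))"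

lemma stop_plus_cont_risk:
  "stop_risk (Suc n) + cont_risk (Suc n) = (\<integral>\<^sup>+y. ennreal (split_risk n y) \<partial>seq_space M (Suc n))"
proof -
  show ?thesis
    unfolding stop_risk_def cont_risk_def
  proof (subst nn_integral_add[symmetric], goal_cases)
    case 3
    show ?case
      unfolding split_risk_def using stp_nonneg cont_bounds[OF _ order_refl] dens_nonneg
        risk_along_nonneg[OF risk_like_future] risk_along_nonneg[OF risk_like_min_risk]
      by (intro nn_integral_cong ennreal_plus[symmetric] mult_nonneg_nonneg add_nonneg_nonneg) auto
  qed measurable
qed

lemma split_risk_measurable [measurable]: "split_risk n \<in> borel_measurable (seq_space M (Suc n))"
  unfolding split_risk_def[abs_def] by measurable

text \<open>
  Since \<open>V = min {l, r}\<close>, a stopping probability \<open>s\<close> pays \<open>s * l + (1 - s) * r\<close> instead of the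
  minimum. The excess is a sum of two nonnegative terms, and both vanish exactly when \<open>s\<close> puts
  no weight on the strictly larger of \<open>l\<close> and \<open>r\<close>.
\<close>

lemma split_risk_excess:
  assumes y: "y \<in> space (seq_space M (Suc n))"
  defines "l \<equiv> min_risk (dens (Suc n) y) (alt (Suc n) y)"
    and "r \<equiv> dens (Suc n) y + future (dens (Suc n) y) (alt (Suc n) y)"
    and "s \<equiv> along \<xi> \<psi> (Suc n) y"
  shows "split_risk n y = cont n y * (real (Suc n) * dens (Suc n) y + limit_value (dens (Suc n) y) (alt (Suc n) y))
     + cont n y * (s * (l - min l r) + (1 - s) * (r - min l r))"
proof -
  have "limit_value (dens (Suc n) y) (alt (Suc n) y) = min l r"
    unfolding l_def r_def by (rule limit_value_eq[OF dens_nonneg[OF y] alt_nonneg[OF y]])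
  moreover have "split_risk n y = cont n y * s * (real (Suc n) * dens (Suc n) y + l)
      + cont n y * (1 - s) * (real (Suc n) * dens (Suc n) y + r)"
    by (simp add: split_risk_def stop_prob_def continue_prob_Suc l_def r_def s_def algebra_simps)
  ultimately show ?thesis by (simp add: algebra_simps)
qed

lemma split_risk_ge:
  assumes y: "y \<in> space (seq_space M (Suc n))"
  shows "cont n y * (real (Suc n) * dens (Suc n) y + limit_value (dens (Suc n) y) (alt (Suc n) y)) \<le> split_risk n y"
  unfolding split_risk_excess[OF y]
  using cont_bounds[OF y, of n] along_psi_bounds[OF y, of "Suc n"] by simp

lemma split_risk_eq_iff:
  assumes y: "y \<in> space (seq_space M (Suc n))"
  defines "l \<equiv> min_risk (dens (Suc n) y) (alt (Suc n) y)"
    and "r \<equiv> dens (Suc n) y + future (dens (Suc n) y) (alt (Suc n) y)"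
    and "s \<equiv> along \<xi> \<psi> (Suc n) y"
  shows "cont n y * (real (Suc n) * dens (Suc n) y + limit_value (dens (Suc n) y) (alt (Suc n) y)) = split_risk n y
    \<longleftrightarrow> (cont n y > 0 \<longrightarrow> indicator {y. l < r} y \<le> s \<and> s \<le> indicator {y. l \<le> r} y)"
proof -
  have s: "0 \<le> s" "s \<le> 1" using along_psi_bounds[OF y, of "Suc n"] by (auto simp: s_def)
  have c: "0 \<le> cont n y" using cont_bounds[OF y, of n] by simp
  show ?thesis
    unfolding split_risk_excess[OF y] l_def[symmetric] r_def[symmetric] s_def[symmetric]
    using s c by (cases l r rule: linorder_cases) (auto simp: min_def)
qed

lemma chosen_risk_le: "chosen_risk n \<le> stop_risk (Suc n) + cont_risk (Suc n)"
  unfolding chosen_risk_eq stop_plus_cont_risk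
  by (intro nn_integral_mono ennreal_leI split_risk_ge)

lemma stopping_condition_iff:
  "stopping_condition X M f0 f1 lam0 lam1 \<xi> \<psi> (Suc n) \<longleftrightarrow>
    (AE y in seq_space M (Suc n). cont n y * (real (Suc n) * dens (Suc n) y
       + limit_value (dens (Suc n) y) (alt (Suc n) y)) = split_risk n y)"
  unfolding stopping_condition_def
proof (intro AE_cong)
  fix y assume y: "y \<in> space (seq_space M (Suc n))"
  show "(y \<in> reach_set M \<xi> \<psi> (Suc n) \<longrightarrow>
        indicator {y. along \<xi> (term_loss f0 f1 lam0 lam1) (Suc n) y
          < dens (Suc n) y + along \<xi> (R_lim X M f0 f1 lam0 lam1) (Suc n) y} y \<le> along \<xi> \<psi> (Suc n) y \<and>
        along \<xi> \<psi> (Suc n) y \<le> indicator {y. along \<xi> (term_loss f0 f1 lam0 lam1) (Suc n) y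
          \<le> dens (Suc n) y + along \<xi> (R_lim X M f0 f1 lam0 lam1) (Suc n) y} y)
    \<longleftrightarrow> cont n y * (real (Suc n) * dens (Suc n) y
       + limit_value (dens (Suc n) y) (alt (Suc n) y)) = split_risk n y"
    unfolding split_risk_eq_iff[OF y] using y
    by (simp add: reach_set_def indicator_def V_along[OF y])
qed

text \<open>
  The inequality \<open>chosen_risk_le\<close> holds for every strategy, so its converse means equality.
\<close>

lemma stopping_condition_iff_risk:
  "stopping_condition X M f0 f1 lam0 lam1 \<xi> \<psi> (Suc n) \<longleftrightarrow>
    stop_risk (Suc n) + cont_risk (Suc n) \<le> chosen_risk n"
proof
  assume le: "stop_risk (Suc n) + cont_risk (Suc n) \<le> chosen_risk n"
  then show "stopping_condition X M f0 f1 lam0 lam1 \<xi> \<psi> (Suc n)"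
    unfolding stopping_condition_iff chosen_risk_eq stop_plus_cont_risk
  proof (rule nn_integral_eq_imp_AE_eq[rotated 3])
    show "(\<integral>\<^sup>+y. ennreal (split_risk n y) \<partial>seq_space M (Suc n)) < \<infinity>"
      using le_less_trans[OF le chosen_risk_finite] unfolding stop_plus_cont_risk .
    fix y assume y: "y \<in> space (seq_space M (Suc n))"
    show "0 \<le> cont n y * (real (Suc n) * dens (Suc n) y + limit_value (dens (Suc n) y) (alt (Suc n) y)) \<and>
      cont n y * (real (Suc n) * dens (Suc n) y + limit_value (dens (Suc n) y) (alt (Suc n) y)) \<le> split_risk n y"
      using split_risk_ge[OF y] cont_bounds[OF y, of n] dens_nonneg[OF y]
        risk_along_nonneg[OF risk_like_limit_value y] by simp
  qed measurable
next
  assume "stopping_condition X M f0 f1 lam0 lam1 \<xi> \<psi> (Suc n)"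
  then show "stop_risk (Suc n) + cont_risk (Suc n) \<le> chosen_risk n"
    unfolding stopping_condition_iff chosen_risk_eq stop_plus_cont_risk
    by (intro nn_integral_mono_AE) (auto elim: eventually_mono)
qed

lemma control_condition_iff:
  "control_condition X M f0 f1 lam0 lam1 \<xi> \<psi> n \<longleftrightarrow>
    (AE y in seq_space M n. cont n y * (real (Suc n) * dens n y + future (dens n y) (alt n y))
       = cont n y * (real (Suc n) * dens n y + chosen n y))"
  unfolding control_condition_def
proof (intro AE_cong)
  fix y assume y: "y \<in> space (seq_space M n)"
  show "(y \<in> continue_set M \<xi> \<psi> n \<longrightarrow>
        (\<integral>z. along \<xi> (V_lim X M f0 f1 lam0 lam1) (Suc n) (y(Suc n := z)) \<partial>M)
          = along \<xi> (R_lim X M f0 f1 lam0 lam1) n y)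
    \<longleftrightarrow> cont n y * (real (Suc n) * dens n y + future (dens n y) (alt n y))
       = cont n y * (real (Suc n) * dens n y + chosen n y)"
    unfolding next_integral_along[OF y] V_along(2)[OF y]
    using y cont_bounds(1)[OF y order_refl] by (auto simp: continue_set_def)
qed

text \<open>
  As for the stopping condition: \<open>cont_risk_le_chosen\<close> is always true, and its converse forces the
  prescribed control to attain the infimum almost everywhere on the paths that continue.
\<close>

lemma control_condition_iff_risk:
  "control_condition X M f0 f1 lam0 lam1 \<xi> \<psi> n \<longleftrightarrow> chosen_risk n \<le> cont_risk n"
proof
  assume "chosen_risk n \<le> cont_risk n"
  then show "control_condition X M f0 f1 lam0 lam1 \<xi> \<psi> n"
    unfolding control_condition_iff chosen_risk_def cont_risk_def
  proof (rule nn_integral_eq_imp_AE_eq[rotated 3])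
    show "(\<integral>\<^sup>+y. ennreal (cont n y * (real (Suc n) * dens n y + chosen n y)) \<partial>seq_space M n) < \<infinity>"
      using chosen_risk_finite unfolding chosen_risk_def .
    fix y assume y: "y \<in> space (seq_space M n)"
    show "0 \<le> cont n y * (real (Suc n) * dens n y + future (dens n y) (alt n y)) \<and>
      cont n y * (real (Suc n) * dens n y + future (dens n y) (alt n y))
        \<le> cont n y * (real (Suc n) * dens n y + chosen n y)"
      using cont_bounds[OF y order_refl] dens_nonneg[OF y] risk_along_nonneg[OF risk_like_future y]
        future_le_chosen[OF y] by (simp add: mult_left_mono)
  qed measurable
next
  assume "control_condition X M f0 f1 lam0 lam1 \<xi> \<psi> n"
  then show "chosen_risk n \<le> cont_risk n"
    unfolding control_condition_iff chosen_risk_def cont_risk_def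
    by (intro nn_integral_mono_AE) (auto elim: eventually_mono)
qed

text \<open>
  An error that is a multiple \<open>e\<close> of the density under \<open>\<theta>\<^sub>0\<close> adds at most \<open>e\<close> to the risk. An error
  bounded by \<open>e\<close> itself would not do, as \<open>\<mu>\<^sup>n\<close> may be infinite.
\<close>

lemma chosen_risk_le_approx:
  assumes e: "0 \<le> e"
    and le: "\<And>y. y \<in> space (seq_space M n) \<Longrightarrow> chosen n y \<le> future (dens n y) (alt n y) + e * dens n y"
  shows "chosen_risk n \<le> cont_risk n + ennreal e"
proof -
  have "chosen_risk n \<le> (\<integral>\<^sup>+y. ennreal (cont n y * (real (Suc n) * dens n y + future (dens n y) (alt n y)))
      + ennreal e * ennreal (cont n y * dens n y) \<partial>seq_space M n)"
    unfolding chosen_risk_def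
  proof (intro nn_integral_mono)
    fix y assume y: "y \<in> space (seq_space M n)"
    have "cont n y * (real (Suc n) * dens n y + chosen n y)
        \<le> cont n y * (real (Suc n) * dens n y + (future (dens n y) (alt n y) + e * dens n y))"
      using le[OF y] cont_bounds[OF y order_refl] by (intro mult_left_mono add_left_mono)
    also have "\<dots> = cont n y * (real (Suc n) * dens n y + future (dens n y) (alt n y))
        + e * (cont n y * dens n y)" by (simp add: algebra_simps)
    finally show "ennreal (cont n y * (real (Suc n) * dens n y + chosen n y))
        \<le> ennreal (cont n y * (real (Suc n) * dens n y + future (dens n y) (alt n y)))
          + ennreal e * ennreal (cont n y * dens n y)"
      using e cont_bounds[OF y order_refl] dens_nonneg[OF y] risk_along_nonneg[OF risk_like_future y]
      by (simp add: ennreal_mult[symmetric] ennreal_plus[symmetric] ennreal_leI del: ennreal_plus)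
  qed
  also have "\<dots> = cont_risk n + (\<integral>\<^sup>+y. ennreal e * ennreal (cont n y * dens n y) \<partial>seq_space M n)"
    unfolding cont_risk_def by (rule nn_integral_add) measurable
  also have "(\<integral>\<^sup>+y. ennreal e * ennreal (cont n y * dens n y) \<partial>seq_space M n) = ennreal e * survival n"
    unfolding survival_def by (rule nn_integral_cmult) measurable
  also have "cont_risk n + ennreal e * survival n \<le> cont_risk n + ennreal e"
    using mult_left_mono[OF survival_le_1, of "ennreal e" n] by (simp add: add_left_mono)
  finally show ?thesis .
qed

text \<open>
  There is only one empty sequence of responses, so the almost everywhere condition at stage \<open>0\<close> is
  a condition at a single point.
\<close>

lemma initial_condition_iff:
  "initial_condition X M f0 f1 lam0 lam1 \<xi> \<longleftrightarrow> control_condition X M f0 f1 lam0 lam1 \<xi> \<psi> 0"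
proof -
  have "along \<xi> (R_lim X M f0 f1 lam0 lam1) 0 (\<lambda>_. undefined)
      = R_lim X M f0 f1 lam0 lam1 0 (\<lambda>_. undefined) (\<lambda>_. undefined)"
    by (simp add: along_def restrict_def)
  moreover have "seq_space M 0 = count_space {\<lambda>_. undefined}" by (simp add: PiM_empty)
  ultimately show ?thesis
    by (simp only: initial_condition_def control_condition_def AE_count_space)
      (simp add: continue_set_def fun_upd_def)
qed

section \<open>The loss of a strategy\<close>

lemma loss_eq: "loss M f0 f1 lam0 lam1 \<xi> \<psi> = (\<Sum>j. stop_risk (Suc j))"
  unfolding loss_def Let_def stop_risk_def
  by (intro arg_cong[where f = suminf] ext nn_integral_cong) (simp add: V_along)

lemma survival_eq_expectation: "survival n = ennreal (stage_expectation M f0 \<xi> n (cont n))"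
proof -
  have nn: "AE y in seq_space M n. 0 \<le> cont n y * dens n y"
    by (intro AE_I2 mult_nonneg_nonneg dens_nonneg cont_bounds(1)[OF _ order_refl])
  have fin: "(\<integral>\<^sup>+y. ennreal (cont n y * dens n y) \<partial>seq_space M n) < \<infinity>"
    using le_less_trans[OF survival_le_1[of n] ennreal_one_less_top] by (simp add: survival_def)
  have "integrable (seq_space M n) (\<lambda>y. cont n y * dens n y)"
    by (rule integrableI_nonneg[OF _ nn fin]) measurable
  from nn_integral_eq_integral[OF this nn] show ?thesis
    by (simp add: survival_def stage_expectation_def)
qed

lemma strategies_iff: "(\<xi>, \<psi>) \<in> strategies X M f0 \<longleftrightarrow> survival \<longlonglongrightarrow> 0"
proof -
  have nn: "0 \<le> stage_expectation M f0 \<xi> n (cont n)" for n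
    unfolding stage_expectation_def
    by (intro Bochner_Integration.integral_nonneg mult_nonneg_nonneg dens_nonneg cont_bounds(1)[OF _ order_refl])
  have "survival \<longlonglongrightarrow> ennreal 0 \<longleftrightarrow> (\<lambda>n. stage_expectation M f0 \<xi> n (cont n)) \<longlonglongrightarrow> 0"
    unfolding survival_eq_expectation[abs_def]
    by (intro tendsto_ennreal_iff always_eventually allI nn) simp
  then show ?thesis using policy rule by (simp add: strategies_def)
qed

lemma survival_telescope: "survival n = (\<Sum>j<i. stop_mass (Suc (j + n))) + survival (i + n)"
proof (induction i)
  case (Suc i)
  then show ?case using survival_Suc[of "i + n"] by (simp add: add.assoc)
qed simp

text \<open>
  \<open>(n + 1) * P(\<tau> > n)\<close> is at most the expectation of \<open>\<tau>\<close> over \<open>{\<tau> > n}\<close>, which the loss after stage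
  \<open>n\<close> contains as its sampling cost. This needs \<open>P(\<tau> = \<infinity>) = 0\<close>.
\<close>

lemma survival_le_tail:
  assumes "survival \<longlonglongrightarrow> 0"
  shows "ennreal (real (Suc n)) * survival n \<le> (\<Sum>j. stop_risk (Suc (j + n)))"
proof -
  let ?c = "ennreal (real (Suc n))" and ?T = "\<Sum>j. stop_risk (Suc (j + n))"
  have "(\<lambda>i. survival (i + n)) \<longlonglongrightarrow> 0" using assms by (rule LIMSEQ_ignore_initial_segment)
  then have "(\<lambda>i. ?T + ?c * survival (i + n)) \<longlonglongrightarrow> ?T + ?c * 0"
    by (intro tendsto_add tendsto_const ennreal_tendsto_cmult) auto
  then have lim: "(\<lambda>i. ?T + ?c * survival (i + n)) \<longlonglongrightarrow> ?T" by simp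
  have "?c * survival n \<le> ?T + ?c * survival (i + n)" for i
  proof -
    have "?c * survival n = (\<Sum>j<i. ?c * stop_mass (Suc (j + n))) + ?c * survival (i + n)"
      by (subst survival_telescope[of n i]) (simp only: distrib_left sum_distrib_left)
    also have "(\<Sum>j<i. ?c * stop_mass (Suc (j + n))) \<le> (\<Sum>j<i. stop_risk (Suc (j + n)))"
      by (intro sum_mono stop_mass_le) simp
    also have "\<dots> \<le> ?T" by (rule sum_le_suminf) auto
    finally show ?thesis by (simp add: add_right_mono)
  qed
  then show ?thesis using lim by (intro LIMSEQ_le_const[OF lim]) auto
qed

lemma cont_risk_le_Suc: "cont_risk n \<le> stop_risk (Suc n) + cont_risk (Suc n)"
  using cont_risk_le_chosen chosen_risk_le by (rule order_trans)

text \<open>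
  The loss if the strategy is followed up to stage \<open>m\<close> and continued optimally from there. For
  \<open>m = 0\<close> it is \<open>1 + R\<^sub>0\<close>, whatever the strategy.
\<close>

definition partial_risk :: "nat \<Rightarrow> ennreal" where
  "partial_risk m = (\<Sum>j<m. stop_risk (Suc j)) + cont_risk m"

lemma partial_risk_mono: "m \<le> n \<Longrightarrow> partial_risk m \<le> partial_risk n"
  by (rule lift_Suc_mono_le) (simp_all add: partial_risk_def add.assoc add_left_mono cont_risk_le_Suc)

text \<open>
  As \<open>m\<close> grows, \<open>partial_risk m\<close> increases. What it contains beyond the loss incurred up to stage
  \<open>m\<close> is at most the loss incurred later plus \<open>lam0 * survival m\<close>, and the latter tends to \<open>0\<close>.
\<close>

lemma partial_risk_le_loss:
  assumes surv: "survival \<longlonglongrightarrow> 0"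
  shows "partial_risk m \<le> loss M f0 f1 lam0 lam1 \<xi> \<psi>"
proof -
  let ?L = "loss M f0 f1 lam0 lam1 \<xi> \<psi>"
  have "(\<lambda>n. ?L + ennreal lam0 * survival n) \<longlonglongrightarrow> ?L + ennreal lam0 * 0"
    by (intro tendsto_add tendsto_const ennreal_tendsto_cmult surv) simp
  then have lim: "(\<lambda>n. ?L + ennreal lam0 * survival n) \<longlonglongrightarrow> ?L" by simp
  have "partial_risk m \<le> ?L + ennreal lam0 * survival n" if "m \<le> n" for n
  proof -
    have "cont_risk n \<le> ennreal (real (Suc n) + lam0) * survival n"
      using cont_risk_le_chosen chosen_risk_le_survival by (rule order_trans)
    also have "\<dots> = ennreal (real (Suc n)) * survival n + ennreal lam0 * survival n"
      using lam0 by (simp only: ennreal_plus of_nat_0_le_iff distrib_right)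
    also have "\<dots> \<le> (\<Sum>j. stop_risk (Suc (j + n))) + ennreal lam0 * survival n"
      by (intro add_right_mono survival_le_tail[OF surv])
    finally have "partial_risk n \<le> (\<Sum>j<n. stop_risk (Suc j)) + (\<Sum>j. stop_risk (Suc (j + n)))
        + ennreal lam0 * survival n"
      unfolding partial_risk_def add.assoc by (rule add_left_mono)
    also have "(\<Sum>j<n. stop_risk (Suc j)) + (\<Sum>j. stop_risk (Suc (j + n))) = ?L"
      unfolding loss_eq by (subst suminf_offset[of "\<lambda>j. stop_risk (Suc j)" n]) (auto simp: add.commute)
    finally show ?thesis using partial_risk_mono[OF that] by (rule order_trans[rotated])
  qed
  then show ?thesis by (intro LIMSEQ_le_const[OF lim]) auto
qed

lemma partial_risk_0: "partial_risk 0 = ennreal (1 + future 1 1)"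
  by (simp add: partial_risk_def cont_risk_0)

text \<open>
  If each stage loses at most \<open>e n\<close>, the partial risks stay below \<open>1 + R\<^sub>0 + E\<close>. They contain the
  sampling cost \<open>(n + 1) * P(\<tau> > n)\<close>, so boundedness alone forces \<open>\<tau>\<close> to be finite. With \<open>e = 0\<close>
  this is the sufficiency of the optimality conditions; with small \<open>e\<close> it produces near-optimal
  strategies.
\<close>

lemma loss_le_if_near_optimal:
  assumes step: "\<And>n. stop_risk (Suc n) + cont_risk (Suc n) \<le> cont_risk n + e n"
    and sum: "\<And>m. (\<Sum>j<m. e j) \<le> E" and E: "E < \<infinity>"
  shows "survival \<longlonglongrightarrow> 0" and "loss M f0 f1 lam0 lam1 \<xi> \<psi> \<le> ennreal (1 + future 1 1) + E"
proof -
  let ?B = "ennreal (1 + future 1 1) + E"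
  have "partial_risk m \<le> ennreal (1 + future 1 1) + (\<Sum>j<m. e j)" for m
  proof (induction m)
    case (Suc m)
    have "partial_risk (Suc m) \<le> partial_risk m + e m"
      using step[of m] by (simp add: partial_risk_def add.assoc add_left_mono)
    also have "\<dots> \<le> ennreal (1 + future 1 1) + (\<Sum>j<m. e j) + e m" by (intro add_right_mono Suc)
    finally show ?case by (simp add: add.assoc)
  qed (simp add: partial_risk_0)
  then have bound: "partial_risk m \<le> ?B" for m
    using order_trans add_left_mono[OF sum] by blast
  show "loss M f0 f1 lam0 lam1 \<xi> \<psi> \<le> ?B"
    unfolding loss_eq
  proof (rule suminf_le_const)
    show "(\<Sum>j<m. stop_risk (Suc j)) \<le> ?B" for m
      using bound[of m] unfolding partial_risk_def by (rule order_trans[rotated]) simp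
  qed simp
  \<comment> \<open>Markov's inequality for \<open>\<tau>\<close>.\<close>
  have le: "survival n \<le> ?B * ennreal (1 / real (Suc n))" for n
  proof -
    have "ennreal (real (Suc n)) * survival n \<le> cont_risk n" by (rule survival_le_cont_risk)
    also have "\<dots> \<le> partial_risk n" unfolding partial_risk_def by simp
    also have "\<dots> \<le> ?B" by (rule bound)
    finally have "ennreal (1 / real (Suc n)) * (ennreal (real (Suc n)) * survival n) \<le> ennreal (1 / real (Suc n)) * ?B"
      by (rule mult_left_mono) simp
    moreover have "ennreal (1 / real (Suc n)) * ennreal (real (Suc n)) = 1"
      by (subst ennreal_mult[symmetric]) auto
    ultimately show ?thesis by (simp add: mult.assoc[symmetric] mult.commute[of ?B])
  qed
  have "(\<lambda>n. ?B * ennreal (1 / real (Suc n))) \<longlonglongrightarrow> ?B * ennreal 0"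
    using E by (intro ennreal_tendsto_cmult tendsto_ennrealI lim_1_over_n[THEN LIMSEQ_Suc]) auto
  then have "(\<lambda>n. ?B * ennreal (1 / real (Suc n))) \<longlonglongrightarrow> 0" by simp
  from tendsto_sandwich[OF always_eventually always_eventually tendsto_const this, of survival]
  show "survival \<longlonglongrightarrow> 0" using le by simp
qed

text \<open>
  Each stage satisfies \<open>cont_risk n \<le> chosen_risk n \<le> stop_risk (n + 1) + cont_risk (n + 1)\<close>. The
  control condition, which at stage \<open>0\<close> is the initial condition, is equality on the left; the
  stopping condition for stage \<open>n + 1\<close> is equality on the right.
\<close>

lemma conditions_iff_stepwise:
  "((\<forall>k\<ge>1. stopping_condition X M f0 f1 lam0 lam1 \<xi> \<psi> k \<and> control_condition X M f0 f1 lam0 lam1 \<xi> \<psi> k)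
      \<and> initial_condition X M f0 f1 lam0 lam1 \<xi>)
    \<longleftrightarrow> (\<forall>n. stop_risk (Suc n) + cont_risk (Suc n) \<le> cont_risk n)"
proof -
  have "((\<forall>k\<ge>1. stopping_condition X M f0 f1 lam0 lam1 \<xi> \<psi> k \<and> control_condition X M f0 f1 lam0 lam1 \<xi> \<psi> k)
      \<and> initial_condition X M f0 f1 lam0 lam1 \<xi>)
    \<longleftrightarrow> (\<forall>n. stopping_condition X M f0 f1 lam0 lam1 \<xi> \<psi> (Suc n)) \<and>
        (\<forall>n. control_condition X M f0 f1 lam0 lam1 \<xi> \<psi> n)"
    unfolding initial_condition_iff by (metis One_nat_def Suc_le_eq not0_implies_Suc zero_less_Suc neq0_conv)
  also have "\<dots> \<longleftrightarrow> (\<forall>n. stop_risk (Suc n) + cont_risk (Suc n) \<le> cont_risk n)"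
    unfolding stopping_condition_iff_risk control_condition_iff_risk
    using cont_risk_le_chosen chosen_risk_le by (meson order_trans)
  finally show ?thesis .
qed

text \<open>
  The partial risks increase from \<open>1 + R\<^sub>0\<close> to at most the loss. If the loss is \<open>1 + R\<^sub>0\<close> they are
  all equal, and as they are finite, consecutive ones may be subtracted.
\<close>

lemma stepwise_if_minimal:
  assumes surv: "survival \<longlonglongrightarrow> 0" and le: "loss M f0 f1 lam0 lam1 \<xi> \<psi> \<le> ennreal (1 + future 1 1)"
  shows "stop_risk (Suc n) + cont_risk (Suc n) \<le> cont_risk n"
proof -
  have eq: "partial_risk m = ennreal (1 + future 1 1)" for m
    using order_trans[OF partial_risk_le_loss[OF surv] le, of m] partial_risk_mono[of 0 m]
    by (simp add: partial_risk_0)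
  have "(\<Sum>j<n. stop_risk (Suc j)) + (stop_risk (Suc n) + cont_risk (Suc n))
      = (\<Sum>j<n. stop_risk (Suc j)) + cont_risk n"
    using eq[of n] eq[of "Suc n"] by (simp add: partial_risk_def add.assoc)
  moreover have "(\<Sum>j<n. stop_risk (Suc j)) \<le> ennreal (1 + future 1 1)"
    unfolding eq[of n, symmetric] partial_risk_def by simp
  then have "(\<Sum>j<n. stop_risk (Suc j)) \<noteq> top" by (rule neq_top_trans[OF ennreal_neq_top])
  ultimately show ?thesis by (simp add: ennreal_add_left_cancel)
qed

end

section \<open>Near-optimal policies and the minimal loss\<close>

context controlled_test
begin

text \<open>
  By homogeneity only the likelihood ratio \<open>t = q / p\<close> matters. The risk of a fixed control grows at
  most at rate \<open>lam1\<close> in \<open>t\<close>, so a control that is good at a grid point is still good on the whole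
  grid cell to its right. The infimum over the controls increases with \<open>t\<close>, so it is not lost
  sight of along the cell. One control for each cell makes a countably valued, hence measurable,
  selector.
\<close>

lemma near_optimal_selector:
  assumes v: "risk_like v" and e: "0 < e"
  shows "\<exists>h\<in>measurable borel X. \<forall>p q. 0 \<le> p \<longrightarrow> 0 \<le> q \<longrightarrow>
    next_value v (h (q / p)) p q \<le> best_next v p q + e * p"
proof -
  define d where "d = e / (2 * (lam1 + 1))"
  have d: "0 < d" "lam1 * d \<le> e / 2" using e lam1 by (auto simp: d_def field_simps)
  have "\<forall>j::int. \<exists>a. a \<in> space X \<and> next_value v a 1 (j * d) \<le> best_next v 1 (j * d) + e / 2"
    using best_next_approx[of "e / 2" v 1] e by (auto simp: Bex_def)
  then obtain g where g: "\<And>j::int. g j \<in> space X"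
    "\<And>j::int. next_value v (g j) 1 (j * d) \<le> best_next v 1 (j * d) + e / 2" by metis
  define h where "h t = g \<lfloor>t / d\<rfloor>" for t
  have "h \<in> measurable borel X"
    unfolding h_def
  proof (rule measurable_compose[of "\<lambda>t. \<lfloor>t / d\<rfloor>" _ "count_space UNIV" g])
    show "(\<lambda>t. \<lfloor>t / d\<rfloor>) \<in> measurable borel (count_space UNIV)" by measurable
    show "g \<in> measurable (count_space UNIV) X" using g(1) by (simp add: measurable_count_space_eq1)
  qed
  moreover have "next_value v (h (q / p)) p q \<le> best_next v p q + e * p" if pq: "0 \<le> p" "0 \<le> q" for p q
  proof (cases "p = 0")
    case True
    have "next_value v (h (q / p)) p q \<le> lam0 * p"
      unfolding h_def by (rule risk_like_le0[OF risk_like_next_value[OF v g(1)] pq])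
    also have "\<dots> = 0 + e * p" using True by simp
    also have "\<dots> \<le> best_next v p q + e * p"
      by (intro add_right_mono risk_like_nonneg[OF risk_like_best_next[OF v] pq])
    finally show ?thesis .
  next
    case False
    then have p: "0 < p" using pq by simp
    \<comment> \<open>The grid point \<open>j * d\<close> lies at most \<open>d\<close> to the left of the likelihood ratio; half of the error
      is spent on the approximate minimum there and half on the distance.\<close>
    define t where "t = q / p"
    define j where "j = \<lfloor>t / d\<rfloor>"
    have t: "0 \<le> t" "q = p * t" using pq p by (auto simp: t_def)
    have "0 \<le> j" using t d by (simp add: j_def)
    then have j: "0 \<le> j * d" using d by simp
    have "j \<le> t / d" "t / d \<le> j + 1" unfolding j_def by linarith+
    then have jt: "j * d \<le> t" "t - j * d \<le> d" using d by (simp_all add: field_simps)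
    note nv = risk_like_next_value[OF v g(1)[of j]] and bn = risk_like_best_next[OF v]
    have "next_value v (g j) 1 t = next_value v (g j) 1 (j * d + (t - j * d))" by simp
    also have "\<dots> \<le> next_value v (g j) 1 (j * d) + lam1 * (t - j * d)"
      using jt j by (intro risk_like_incr1[OF nv]) auto
    also have "\<dots> \<le> best_next v 1 (j * d) + e / 2 + lam1 * d"
      using g(2)[of j] jt lam1 by (intro add_mono mult_left_mono) auto
    also have "\<dots> \<le> best_next v 1 t + e"
      using risk_like_mono[OF bn, of 1 "j * d" 1 t] j jt d by simp
    finally have "p * next_value v (g j) 1 t \<le> p * (best_next v 1 t + e)"
      using p by (intro mult_left_mono) auto
    then show ?thesis
      using risk_like_scale[OF nv _ t(1) p, of 1] risk_like_scale[OF bn _ t(1) p, of 1] t(2) p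
      by (simp add: h_def t_def[symmetric] j_def[symmetric] algebra_simps)
  qed
  ultimately show ?thesis by blast
qed

text \<open>
  Stop as soon as that is no worse than continuing, and otherwise apply at stage \<open>n + 1\<close> the control
  of a selector with relative error \<open>e / 2\<^sup>n\<^sup>+\<^sup>1\<close>, so that the errors sum to at most \<open>e\<close>.
\<close>

lemma near_optimal_strategy:
  assumes e: "0 < e"
  shows "\<exists>\<xi> \<psi>. (\<xi>, \<psi>) \<in> strategies X M f0 \<and>
    loss M f0 f1 lam0 lam1 \<xi> \<psi> \<le> ennreal (1 + best_next limit_value 1 1) + ennreal e"
proof -
  define d where "d n = e * (1 / 2) ^ Suc n" for n
  have d: "0 < d n" for n using e by (simp add: d_def)
  have "\<forall>n. \<exists>h. h \<in> measurable borel X \<and> (\<forall>p q. 0 \<le> p \<longrightarrow> 0 \<le> q \<longrightarrow>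
      next_value limit_value (h (q / p)) p q \<le> best_next limit_value p q + d n * p)"
    using near_optimal_selector[OF risk_like_limit_value d] by blast
  then obtain h where h: "\<And>n. h n \<in> measurable borel X"
    "\<And>n p q. 0 \<le> p \<Longrightarrow> 0 \<le> q \<Longrightarrow>
      next_value limit_value (h n (q / p)) p q \<le> best_next limit_value p q + d n * p" by metis
  define \<xi> :: "('x, 'y) policy"
    where "\<xi> n x y = h (n - 1) (joint_density f1 (n - 1) x y / joint_density f0 (n - 1) x y)" for n x y
  define \<psi> :: "('x, 'y) stage_fun"
    where "\<psi> n x y = of_bool (min_risk (joint_density f0 n x y) (joint_density f1 n x y)
      \<le> joint_density f0 n x y + best_next limit_value (joint_density f0 n x y) (joint_density f1 n x y))" for n x y
  note jd = joint_density_measurable[OF dens0 measurable_fst measurable_snd]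
    joint_density_measurable[OF dens1 measurable_fst measurable_snd]
  have policy: "control_policy X M \<xi>"
    unfolding control_policy_def
  proof (intro allI impI)
    fix n :: nat
    let ?N = "seq_space X (n - 1) \<Otimes>\<^sub>M seq_space M (n - 1)"
    have "(\<lambda>w. h (n - 1) (joint_density f1 (n - 1) (fst w) (snd w) / joint_density f0 (n - 1) (fst w) (snd w)))
        \<in> measurable ?N X"
      by (rule measurable_compose[OF borel_measurable_divide[OF jd(2) jd(1)] h(1)])
    then show "case_prod (\<xi> n) \<in> measurable ?N X" by (simp add: \<xi>_def case_prod_beta')
  qed
  have rule: "stopping_rule X M \<psi>"
    unfolding stopping_rule_def
  proof (intro allI impI conjI ballI)
    fix n :: nat
    let ?N = "seq_space X n \<Otimes>\<^sub>M seq_space M n"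
    have nn: "0 \<le> joint_density f0 n (fst w) (snd w)" "0 \<le> joint_density f1 n (fst w) (snd w)"
      if "w \<in> space ?N" for w
      using that by (auto simp: space_pair_measure intro: joint_density_nonneg[OF dens0] joint_density_nonneg[OF dens1])
    have m: "(\<lambda>w. v (joint_density f0 n (fst w) (snd w)) (joint_density f1 n (fst w) (snd w))) \<in> borel_measurable ?N"
      if "risk_like v" for v
      by (rule risk_like_measurable[OF that jd nn])
    note [measurable] = m[OF risk_like_min_risk] m[OF risk_like_best_next[OF risk_like_limit_value]] jd(1)
    have "(\<lambda>w. \<psi> n (fst w) (snd w)) \<in> borel_measurable ?N"
      unfolding \<psi>_def by measurable
    then show "case_prod (\<psi> n) \<in> borel_measurable ?N" by (simp add: case_prod_beta')
  qed (simp add: \<psi>_def)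
  interpret test_strategy M X f0 f1 lam0 lam1 \<xi> \<psi>
    by unfold_locales (fact policy rule)+
  have "chosen n y \<le> future (dens n y) (alt n y) + d n * dens n y" if y: "y \<in> space (seq_space M n)" for n y
  proof -
    have "next_control \<xi> n y = h n (alt n y / dens n y)"
      by (simp add: next_control_def \<xi>_def along_def)
    then show ?thesis using h(2)[OF dens_nonneg[OF y] alt_nonneg[OF y]] by simp
  qed
  then have "chosen_risk n \<le> cont_risk n + ennreal (d n)" for n
    using d by (intro chosen_risk_le_approx) (auto simp: less_imp_le)
  moreover have "stopping_condition X M f0 f1 lam0 lam1 \<xi> \<psi> (Suc n)" for n
    unfolding stopping_condition_iff
  proof (intro AE_I2)
    fix y assume y: "y \<in> space (seq_space M (Suc n))"
    show "cont n y * (real (Suc n) * dens (Suc n) y + limit_value (dens (Suc n) y) (alt (Suc n) y)) = split_risk n y"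
      unfolding split_risk_eq_iff[OF y] by (auto simp: along_def \<psi>_def indicator_def)
  qed
  ultimately have step: "stop_risk (Suc n) + cont_risk (Suc n) \<le> cont_risk n + ennreal (d n)" for n
    unfolding stopping_condition_iff_risk by (rule order_trans[rotated])
  have "(\<Sum>j<m. ennreal (d j)) \<le> ennreal e" for m
  proof -
    have "(\<Sum>j<m. d j) = e * (1 - (1 / 2) ^ m)"
      by (induction m) (auto simp: d_def algebra_simps)
    also have "\<dots> \<le> e" using e by (simp add: algebra_simps)
    finally show ?thesis using d by (subst sum_ennreal) (auto simp: less_imp_le intro: ennreal_leI)
  qed
  from loss_le_if_near_optimal[OF step this] show ?thesis
    unfolding strategies_iff[symmetric] by auto
qed

text \<open>
  The partial risk at stage \<open>0\<close> is a lower bound, and near-optimal strategies come arbitrarily close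
  to it.
\<close>

lemma minimal_loss:
  "(INF (\<xi>, \<psi>)\<in>strategies X M f0. loss M f0 f1 lam0 lam1 \<xi> \<psi>) = ennreal (1 + best_next limit_value 1 1)"
  (is "?I = ?B")
proof (rule antisym)
  show "?I \<le> ?B"
  proof (rule ennreal_le_epsilon)
    fix e :: real assume "0 < e"
    from near_optimal_strategy[OF this] obtain \<xi> \<psi> where
      "(\<xi>, \<psi>) \<in> strategies X M f0" "loss M f0 f1 lam0 lam1 \<xi> \<psi> \<le> ?B + ennreal e" by blast
    then show "?I \<le> ?B + ennreal e" by (intro INF_lower2[of "(\<xi>, \<psi>)"]) auto
  qed
  show "?B \<le> ?I"
  proof (rule INF_greatest, clarify)
    fix \<xi> \<psi> assume s: "(\<xi>, \<psi>) \<in> strategies X M f0"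
    then interpret test_strategy M X f0 f1 lam0 lam1 \<xi> \<psi>
      by unfold_locales (auto simp: strategies_def)
    show "?B \<le> loss M f0 f1 lam0 lam1 \<xi> \<psi>"
      using partial_risk_le_loss[of 0] s by (simp add: strategies_iff partial_risk_0)
  qed
qed

end

section \<open>Characterisation of optimal strategies\<close>

theorem theorem5p5:
  fixes X :: "'x measure" and M :: "'y measure"
    and f0 f1 :: "'x \<Rightarrow> 'y \<Rightarrow> real" and lam0 lam1 :: real
  assumes "sigma_finite_measure M"
    and "cond_density X M f0" and "cond_density X M f1"
    and "lam0 \<ge> 0" and "lam1 \<ge> 0"
    and "standing_assumption X M f0 f1 lam0 lam1"
  shows
    "(\<forall>\<xi> \<psi>. (\<xi>, \<psi>) \<in> strategies X M f0 \<and> optimal X M f0 f1 lam0 lam1 \<xi> \<psi> \<longrightarrow>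
        (\<forall>k\<ge>1. stopping_condition X M f0 f1 lam0 lam1 \<xi> \<psi> k \<and>
               control_condition X M f0 f1 lam0 lam1 \<xi> \<psi> k) \<and>
        initial_condition X M f0 f1 lam0 lam1 \<xi>)
     \<and>
     (\<forall>\<xi> \<psi>. control_policy X M \<xi> \<and> stopping_rule X M \<psi> \<and>
        (\<forall>k\<ge>1. stopping_condition X M f0 f1 lam0 lam1 \<xi> \<psi> k \<and>
               control_condition X M f0 f1 lam0 lam1 \<xi> \<psi> k) \<and>
        initial_condition X M f0 f1 lam0 lam1 \<xi> \<longrightarrow>
        (\<xi>, \<psi>) \<in> strategies X M f0 \<and> optimal X M f0 f1 lam0 lam1 \<xi> \<psi>)"
proof -
  have "(\<lambda>_. undefined) \<in> space (seq_space X 0)" "(\<lambda>_. undefined) \<in> space (seq_space M 0)"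
    by (simp_all add: space_PiM)
  then have "\<exists>a. is_arg_min (next_integral M 0 (V_lim X M f0 f1 lam0 lam1 (Suc 0)) (\<lambda>_. undefined) (\<lambda>_. undefined))
      (\<lambda>a. a \<in> space X) a"
    using assms(6) unfolding standing_assumption_def by blast
  then have "space X \<noteq> {}" by (auto simp: is_arg_min_def)
  then interpret controlled_test M X f0 f1 lam0 lam1
    using assms by (simp add: controlled_test_def controlled_test_axioms_def)
  have optimal_iff: "optimal X M f0 f1 lam0 lam1 \<xi> \<psi> \<longleftrightarrow>
      loss M f0 f1 lam0 lam1 \<xi> \<psi> = ennreal (1 + best_next limit_value 1 1)" for \<xi> \<psi>
    unfolding optimal_def minimal_loss ..
  show ?thesis
  proof (rule conjI; intro allI impI; elim conjE)
    fix \<xi> :: "('x, 'y) policy" and \<psi> :: "('x, 'y) stage_fun"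
    assume s: "(\<xi>, \<psi>) \<in> strategies X M f0" and opt: "optimal X M f0 f1 lam0 lam1 \<xi> \<psi>"
    from s interpret test_strategy M X f0 f1 lam0 lam1 \<xi> \<psi>
      by unfold_locales (auto simp: strategies_def)
    show "(\<forall>k\<ge>1. stopping_condition X M f0 f1 lam0 lam1 \<xi> \<psi> k \<and>
             control_condition X M f0 f1 lam0 lam1 \<xi> \<psi> k) \<and>
          initial_condition X M f0 f1 lam0 lam1 \<xi>"
      unfolding conditions_iff_stepwise
      using s opt by (auto simp: strategies_iff optimal_iff intro: stepwise_if_minimal)
  next
    fix \<xi> :: "('x, 'y) policy" and \<psi> :: "('x, 'y) stage_fun"
    assume "control_policy X M \<xi>" "stopping_rule X M \<psi>"
      and conds: "\<forall>k\<ge>1. stopping_condition X M f0 f1 lam0 lam1 \<xi> \<psi> k \<and>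
        control_condition X M f0 f1 lam0 lam1 \<xi> \<psi> k" "initial_condition X M f0 f1 lam0 lam1 \<xi>"
    then interpret test_strategy M X f0 f1 lam0 lam1 \<xi> \<psi> by unfold_locales
    have "stop_risk (Suc n) + cont_risk (Suc n) \<le> cont_risk n + 0" for n
      using conds conditions_iff_stepwise by simp
    from loss_le_if_near_optimal[OF this, of 0] have surv: "survival \<longlonglongrightarrow> 0"
      and le: "loss M f0 f1 lam0 lam1 \<xi> \<psi> \<le> ennreal (1 + best_next limit_value 1 1)" by auto
    show "(\<xi>, \<psi>) \<in> strategies X M f0 \<and> optimal X M f0 f1 lam0 lam1 \<xi> \<psi>"
      using surv le partial_risk_le_loss[OF surv, of 0]
      by (simp add: strategies_iff optimal_iff partial_risk_0)
  qed
qed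

end
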